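(* Let $N\ge1$ and let $\Omega\subset\mathbb{R}^N$ be a bounded domain with smooth boundary. Let $\{r_k\}\subset(0,1)$ satisfy $r_k\searrow0$ as $k\nearrow+\infty$. Then $$\lim_{k\nearrow+\infty}\lambda_1(r_k)=1,$$ where $\lambda_1(r)$ denotes the first eigenvalue of the fractional Dirichlet Laplacian of order $r$ on $\Omega$.
   Context: $H_0:=\{v\in L^2(\mathbb{R}^N): v=0 \text{ a.e. in }\mathbb{R}^N\setminus\Omega\}$ with the $L^2(\mathbb{R}^N)$ norm. For $r\in(0,1)$, $C(r):=\left(\int_{\mathbb{R}^N}\frac{1-\cos\zeta_1}{|\zeta|^{N+2r}}\,d\zeta\right)^{-1}$, $[v]_{H^r(\mathbb{R}^N)}^2:=\iint_{\mathbb{R}^{2N}}\frac{|v(x)-v(y)|^2}{|x-y|^{N+2r}}\,dx\,dy$, and $\mathcal{X}_{r,0}:=\{v\in H^r(\mathbb{R}^N): v=0\text{ a.e. in }\mathbb{R}^N\setminus\Omega\}$. With this normalization, $\frac{C(r)}2[v]_{H^r(\mathbb{R}^N)}^2=\||\xi|^r\hat v\|_{L^2(\mathbb{R}^N)}^2$, $\hat v$ being the unitary Fourier transform. The first eigenvalue is $$\lambda_1(r)=\min_{v\in\mathcal{X}_{r,0},\ \|v\|_{H_0}=1}\frac{C(r)}2[v]_{H^r(\mathbb{R}^N)}^2,$$ i.e. the smallest $\lambda$ for which there is $v\in\mathcal{X}_{r,0}\setminus\{0\}$ with $\frac{C(r)}2\iint_{\mathbb{R}^{2N}}\frac{(v(x)-v(y))(\phi(x)-\phi(y))}{|x-y|^{N+2r}}\,dx\,dy=\lambda\int_\Omega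 v\phi\,dx$ for all $\phi\in\mathcal{X}_{r,0}$. *)

theory Defs
  imports "HOL-Analysis.Analysis"
begin

primrec C_k :: "nat \<Rightarrow> (real^'n \<Rightarrow> real) \<Rightarrow> bool" where
  "C_k 0 f \<longleftrightarrow> continuous_on UNIV f"
| "C_k (Suc k) f \<longleftrightarrow>
     (\<forall>x. f differentiable at x) \<and>
     (\<forall>j. C_k k (\<lambda>x. frechet_derivative f (at x) (axis j 1)))"

definition C_infinity :: "(real^'n \<Rightarrow> real) \<Rightarrow> bool" where
  "C_infinity f \<longleftrightarrow> (\<forall>k. C_k k f)"

text \<open>Near each boundary point, up to relabelling and reflecting the coordinates, the set is
  the region above the graph of a smooth function of the other \<open>N - 1\<close> coordinates. Such a
  function is encoded as a function on the whole space evaluated at the point whose \<open>j\<close>-th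
  coordinate has been reset to \<open>0\<close>.\<close>

definition smooth_boundary :: "(real^'n) set \<Rightarrow> bool" where
  "smooth_boundary \<Omega> \<longleftrightarrow>
     (\<forall>p \<in> frontier \<Omega>. \<exists>\<delta>>0. \<exists>j. \<exists>s\<in>{1, -1}. \<exists>\<gamma>. C_infinity \<gamma> \<and>
        (\<forall>x \<in> ball p \<delta>. x \<in> \<Omega> \<longleftrightarrow> s * x $ j > \<gamma> (\<chi> l. if l = j then 0 else x $ l)))"

definition bounded_smooth_domain :: "(real^'n) set \<Rightarrow> bool" where
  "bounded_smooth_domain \<Omega> \<longleftrightarrow>
     open \<Omega> \<and> connected \<Omega> \<and> \<Omega> \<noteq> {} \<and> bounded \<Omega> \<and> smooth_boundary \<Omega>"

text \<open>Elements of the function spaces are Borel representatives; every class in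
  \<open>L\<^sup>2(\<real>\<^sup>N)\<close> contains one, and all quantities below depend only on the class.\<close>

definition L2 :: "(real^'n \<Rightarrow> real) set" where
  "L2 = {v. v \<in> borel_measurable borel \<and> integrable lborel (\<lambda>x. (v x)\<^sup>2)}"

definition L2_norm :: "(real^'n \<Rightarrow> real) \<Rightarrow> real" where
  "L2_norm v = sqrt (\<integral>x. (v x)\<^sup>2 \<partial>lborel)"

text \<open>On the diagonal the integrand is \<open>0 / 0 = 0\<close>; the diagonal is a null set.\<close>

definition gagliardo_integrand ::
    "real \<Rightarrow> (real^'n \<Rightarrow> real) \<Rightarrow> (real^'n) \<times> (real^'n) \<Rightarrow> real" where
  "gagliardo_integrand r v =
     (\<lambda>(x, y). \<bar>v x - v y\<bar>\<^sup>2 / norm (x - y) powr (real CARD('n) + 2 * r))"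

definition H_space :: "real \<Rightarrow> (real^'n \<Rightarrow> real) set" where
  "H_space r = {v \<in> L2. integrable (lborel \<Otimes>\<^sub>M lborel) (gagliardo_integrand r v)}"

definition gagliardo_sq :: "real \<Rightarrow> (real^'n \<Rightarrow> real) \<Rightarrow> real" where
  "gagliardo_sq r v = (\<integral>z. gagliardo_integrand r v z \<partial>(lborel \<Otimes>\<^sub>M lborel))"

definition X_space :: "(real^'n) set \<Rightarrow> real \<Rightarrow> (real^'n \<Rightarrow> real) set" where
  "X_space \<Omega> r = {v \<in> H_space r. AE x in lborel. x \<notin> \<Omega> \<longrightarrow> v x = 0}"

text \<open>The finite index type \<open>'n\<close> carries no order, so the index \<open>i\<close> singles out the coordinate
  called \<open>\<zeta>\<^sub>1\<close>. By symmetry of the integral the value does not depend on it.\<close>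

definition C_const :: "'n::finite \<Rightarrow> real \<Rightarrow> real" where
  "C_const i r =
     inverse (\<integral>\<zeta>. (1 - cos (\<zeta> $ i)) / norm \<zeta> powr (real CARD('n) + 2 * r)
        \<partial>(lborel :: (real^'n) measure))"

text \<open>\<open>LEAST\<close> renders the minimum literally: unlike an infimum, its value is specified only
  when the minimum is attained.\<close>

definition first_eigenvalue :: "'n::finite \<Rightarrow> (real^'n) set \<Rightarrow> real \<Rightarrow> real" where
  "first_eigenvalue i \<Omega> r =
     (LEAST m. \<exists>v \<in> X_space \<Omega> r. L2_norm v = 1 \<and> m = C_const i r / 2 * gagliardo_sq r v)"

end

theory Submission
  imports Defs "HOL-Real_Asymp.Real_Asymp"
begin

text \<open>Write \<open>k\<^sub>r(z) = |z|\<^bsup>-(N+2r)\<^esup>\<close> and let \<open>J(r)\<close> be its mass on \<open>|z| \<ge> 1\<close>; by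
  scaling the mass on \<open>|z| \<ge> d\<close> is \<open>d\<^bsup>-2r\<^esup> J(r)\<close>, and \<open>J(r) \<rightarrow> \<infinity>\<close> as \<open>r \<rightarrow> 0\<close>.
  No Fourier transform is needed. The part of \<open>1/C(r)\<close> over \<open>|z| < 1\<close> is bounded, and the cosine
  oscillates away against the slowly varying tail, so \<open>C(r) J(r) \<rightarrow> 1\<close>. If \<open>\<Omega>\<close> has diameter
  less than \<open>R\<close>, pairs at distance at least \<open>R\<close> alone contribute
  \<open>2 R\<^bsup>-2r\<^esup> J(r) \<parallel>v\<parallel>\<^sup>2\<close> to \<open>[v]\<^sub>r\<^sup>2\<close>, while for a fixed
  nonnegative Lipschitz \<open>v\<close> one has \<open>[v]\<^sub>r\<^sup>2 \<le> const + 2 J(r) \<parallel>v\<parallel>\<^sup>2\<close>; both bounds,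
  multiplied by \<open>C(r)/2\<close>, tend to \<open>\<parallel>v\<parallel>\<^sup>2\<close>.

  That the minimum is attained follows without a compact embedding. Since
  \<open>\<rho> \<mapsto> [sqrt \<rho>]\<^sub>r\<^sup>2\<close> is convex with a quantitative defect, normalising nonnegative
  near-minimizers by their integrals gives an \<open>L\<^sup>1\<close>-Cauchy family; the inequality
  \<open>2 d\<^bsup>-2r\<^esup> J(r) \<parallel>w\<parallel>\<^sub>2\<^sup>2 \<le> [w]\<^sub>r\<^sup>2 + 2 d\<^bsup>-(N+2r)\<^esup> \<parallel>w\<parallel>\<^sub>1\<^sup>2\<close> with \<open>d\<close> small upgrades this
  to \<open>L\<^sup>2\<close> convergence, and Fatou's lemma shows that the limit is a minimizer.\<close>

section \<open>Powers of the norm\<close>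

lemma nn_integral_lborel_affine:
  fixes f :: "'a::euclidean_space \<Rightarrow> ennreal"
  assumes [measurable]: "f \<in> borel_measurable borel" and "c \<noteq> 0"
  shows "(\<integral>\<^sup>+x. f x \<partial>lborel) = ennreal (\<bar>c\<bar> ^ DIM('a)) * (\<integral>\<^sup>+x. f (t + c *\<^sub>R x) \<partial>lborel)"
  by (subst lborel_affine[OF assms(2), of t])
     (simp add: nn_integral_density nn_integral_distr nn_integral_cmult)

lemma nn_integral_lborel_reflect:
  fixes f :: "'a::euclidean_space \<Rightarrow> ennreal"
  assumes "f \<in> borel_measurable borel"
  shows "(\<integral>\<^sup>+x. f (t - x) \<partial>lborel) = (\<integral>\<^sup>+x. f x \<partial>lborel)"
  using nn_integral_lborel_affine[OF assms, of "-1" t] by simp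

text \<open>The integrand is homogeneous of degree \<open>- p\<close> and Lebesgue measure of degree
  \<open>DIM('a)\<close>; the indicator of \<open>B\<close> at \<open>z /\<^sub>R s\<close> is that
  of the dilate of \<open>B\<close> by \<open>s\<close>.\<close>

lemma nn_integral_powr_scale:
  fixes p :: real and B :: "'a::euclidean_space set"
  assumes "s > 0" and [measurable]: "B \<in> sets borel"
  shows "(\<integral>\<^sup>+z. ennreal (norm z powr - p) * indicator B (z /\<^sub>R s) \<partial>lborel) =
    ennreal (s powr (DIM('a) - p)) * (\<integral>\<^sup>+z. ennreal (norm z powr - p) * indicator B z \<partial>lborel)"
proof -
  have "(\<integral>\<^sup>+z. ennreal (norm z powr - p) * indicator B (z /\<^sub>R s) \<partial>lborel) =
     ennreal (\<bar>s\<bar> ^ DIM('a)) *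
       (\<integral>\<^sup>+z. ennreal (norm (0 + s *\<^sub>R z) powr - p) * indicator B ((0 + s *\<^sub>R z) /\<^sub>R s) \<partial>lborel)"
    using assms(1) by (intro nn_integral_lborel_affine) auto
  also have "\<dots> = ennreal (\<bar>s\<bar> ^ DIM('a)) *
       (\<integral>\<^sup>+z. ennreal (s powr - p) * (ennreal (norm z powr - p) * indicator B z) \<partial>lborel)"
    using assms(1)
    by (simp add: powr_mult ennreal_mult mult.assoc)
  also have "\<dots> = ennreal (\<bar>s\<bar> ^ DIM('a) * s powr - p) *
       (\<integral>\<^sup>+z. ennreal (norm z powr - p) * indicator B z \<partial>lborel)"
    using assms(1) by (simp add: nn_integral_cmult ennreal_mult mult.assoc)
  also have "\<bar>s\<bar> ^ DIM('a) * s powr - p = s powr (DIM('a) - p)"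
    using assms(1) by (simp add: powr_diff powr_minus_divide powr_realpow)
  finally show ?thesis .
qed

text \<open>The dilates by \<open>s ^ k\<close> of the annulus \<open>B\<close> with radii 1/2 and 2
  cover \<open>T\<close>, and by homogeneity their masses form a geometric series of ratio
  \<open>s powr (DIM('a) - p)\<close>. The factor \<open>s = 2\<close> handles the tail at infinity
  and \<open>s = 1/2\<close> the singularity at the origin.\<close>

lemma nn_integral_powr_geometric_finite:
  fixes p :: real and T :: "'a::euclidean_space set"
  assumes s: "s > 0" "s powr (DIM('a) - p) < 1" and "p \<ge> 0" and [measurable]: "T \<in> sets borel"
    and cover: "\<And>z. z \<in> T \<Longrightarrow> \<exists>k::nat. norm z / s ^ k \<in> {1/2..2}"
  shows "(\<integral>\<^sup>+z. ennreal (norm z powr - p) * indicator T z \<partial>lborel) < \<infinity>"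
proof -
  define B :: "'a set" where "B = {z. 1/2 \<le> norm z \<and> norm z \<le> 2}"
  have [measurable]: "B \<in> sets borel" unfolding B_def by measurable
  define A where "A = (\<integral>\<^sup>+z. ennreal (norm z powr - p) * indicator B z \<partial>lborel)"
  define q where "q = s powr (DIM('a) - p)"
  have q: "0 \<le> q" "q < 1" using s by (auto simp: q_def)
  have "A \<le> (\<integral>\<^sup>+z. ennreal (2 powr p) * indicator (cball 0 2) (z::'a) \<partial>lborel)"
    unfolding A_def
  proof (rule nn_integral_mono)
    fix z :: 'a
    show "ennreal (norm z powr - p) * indicator B z \<le> ennreal (2 powr p) * indicator (cball 0 2) z"
    proof (cases "z \<in> B")
      case True
      then have "norm z powr - p \<le> (1/2) powr - p"
        using \<open>p \<ge> 0\<close> by (intro powr_mono2') (auto simp: B_def)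
      also have "\<dots> = 2 powr p" by (simp add: powr_minus powr_divide)
      finally show ?thesis using True by (auto simp: B_def ennreal_leI)
    qed simp
  qed
  also have "\<dots> < \<infinity>"
    using emeasure_lborel_cball_finite[of "0::'a" 2]
    by (simp add: nn_integral_cmult_indicator ennreal_mult_less_top)
  finally have A: "A < \<infinity>" .
  have "(\<integral>\<^sup>+z. ennreal (norm z powr - p) * indicator T z \<partial>lborel) \<le>
        (\<integral>\<^sup>+z. (\<Sum>k. ennreal (norm z powr - p) * indicator B (z /\<^sub>R s ^ k)) \<partial>lborel)"
  proof (rule nn_integral_mono)
    fix z :: 'a
    show "ennreal (norm z powr - p) * indicator T z \<le>
      (\<Sum>k. ennreal (norm z powr - p) * indicator B (z /\<^sub>R s ^ k))"
    proof (cases "z \<in> T")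
      case True
      then obtain k :: nat where "norm z / s ^ k \<in> {1/2..2}" using cover by blast
      moreover have "norm (z /\<^sub>R s ^ k) = norm z / s ^ k"
        using s by (simp add: divide_inverse_commute)
      ultimately have "z /\<^sub>R s ^ k \<in> B" by (simp add: B_def)
      then have "ennreal (norm z powr - p) * indicator T z =
          (\<Sum>k\<in>{k}. ennreal (norm z powr - p) * indicator B (z /\<^sub>R s ^ k))"
        using True by simp
      also have "\<dots> \<le> (\<Sum>k. ennreal (norm z powr - p) * indicator B (z /\<^sub>R s ^ k))"
        by (rule sum_le_suminf) auto
      finally show ?thesis .
    qed simp
  qed
  also have "\<dots> = (\<Sum>k. (\<integral>\<^sup>+z. ennreal (norm z powr - p) * indicator B (z /\<^sub>R s ^ k) \<partial>lborel))"
    by (rule nn_integral_suminf) simp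
  also have "\<dots> = (\<Sum>k. ennreal (q ^ k) * A)"
  proof (rule arg_cong[of _ _ suminf], rule ext)
    fix k
    have "(s ^ k) powr (DIM('a) - p) = (s powr k) powr (DIM('a) - p)"
      using s by (simp only: powr_realpow)
    also have "\<dots> = q powr k" unfolding q_def powr_powr by (simp only: mult.commute)
    also have "\<dots> = q ^ k" using s by (intro powr_realpow) (simp add: q_def)
    finally have "(s ^ k) powr (DIM('a) - p) = q ^ k" .
    then show "(\<integral>\<^sup>+z. ennreal (norm z powr - p) * indicator B (z /\<^sub>R s ^ k) \<partial>lborel) = ennreal (q ^ k) * A"
      using nn_integral_powr_scale[of "s^k" B p] s by (simp add: A_def)
  qed
  also have "\<dots> = (\<Sum>k. ennreal (q ^ k)) * A"
    by (rule ennreal_suminf_multc)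
  also have "(\<Sum>k. ennreal (q ^ k)) = ennreal (\<Sum>k. q ^ k)"
    using q by (simp add: suminf_ennreal2 summable_geometric)
  also have "ennreal (\<Sum>k. q ^ k) * A < \<infinity>"
    using A by (simp add: ennreal_mult_less_top)
  finally show ?thesis .
qed

lemma ex_dyadic:
  assumes "x \<ge> (1::real)"
  shows "\<exists>k::nat. x / 2 ^ k \<in> {1..2}"
proof -
  define k where "k = nat \<lfloor>log 2 x\<rfloor>"
  have "0 \<le> log 2 x" using assms by simp
  then have k: "real k \<le> log 2 x" "log 2 x < real k + 1"
    unfolding k_def by linarith+
  have "2 powr k \<le> x" using k(1) assms by (simp add: le_log_iff)
  moreover have "x < 2 powr (k + 1)" using k(2) assms by (simp add: log_less_iff add.commute)
  ultimately show ?thesis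
    by (intro exI[of _ k]) (simp add: powr_realpow powr_add divide_simps)
qed

lemma nn_integral_powr_tail_finite:
  fixes p :: real
  assumes "p > DIM('a)"
  shows "(\<integral>\<^sup>+z. ennreal (norm z powr - p) * indicator {z. 1 \<le> norm z} (z::'a::euclidean_space) \<partial>lborel) < \<infinity>"
proof (rule nn_integral_powr_geometric_finite[where s = 2])
  show "2 powr (real DIM('a) - p) < 1" using assms by (simp add: powr_less_one)
  show "0 \<le> p" using assms by linarith
  show "{z::'a. 1 \<le> norm z} \<in> sets borel" by measurable
  fix z :: 'a assume "z \<in> {z. 1 \<le> norm z}"
  then obtain k :: nat where "norm z / 2 ^ k \<in> {1..2}" using ex_dyadic[of "norm z"] by auto
  then show "\<exists>k::nat. norm z / 2 ^ k \<in> {1 / 2..2}" by (intro exI[of _ k]) (auto simp: field_simps intro: order_trans)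
qed simp

lemma nn_integral_powr_near_finite:
  fixes p :: real
  assumes "0 \<le> p" "p < DIM('a)"
  shows "(\<integral>\<^sup>+z. ennreal (norm z powr - p) * indicator (cball 0 1) (z::'a::euclidean_space) \<partial>lborel) < \<infinity>"
proof -
  \<comment> \<open>The origin lies in no dilate of the annulus, but it can be removed:
    \<open>0 powr - p\<close> is \<open>0\<close>, so the two integrands agree at every
    point.\<close>
  have "(\<integral>\<^sup>+z. ennreal (norm z powr - p) * indicator (cball 0 1) (z::'a) \<partial>lborel) =
    (\<integral>\<^sup>+z. ennreal (norm z powr - p) * indicator (cball 0 1 - {0}) (z::'a) \<partial>lborel)"
    by (intro nn_integral_cong) (auto simp: indicator_def)
  also have "\<dots> < \<infinity>"
  proof (rule nn_integral_powr_geometric_finite[where s = "1/2"])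
    show "(1/2) powr (real DIM('a) - p) < 1" using assms by (simp add: powr_divide powr_less_one)
    fix z :: 'a assume "z \<in> cball 0 1 - {0}"
    then have z: "norm z > 0" "norm z \<le> 1" by auto
    then obtain k :: nat where "(1 / norm z) / 2 ^ k \<in> {1..2}" using ex_dyadic[of "1 / norm z"] by auto
    \<comment> \<open>This quotient is the reciprocal of \<open>(1 / norm z) / 2 ^ k\<close>, hence
      lies between 1/2 and 1; the window from 1/2 to 2 accommodates both uses of the covering
      lemma.\<close>
    then show "\<exists>k::nat. norm z / (1/2) ^ k \<in> {1 / 2..2}"
      using z by (intro exI[of _ k]) (simp add: power_divide divide_simps mult.commute)
  qed (use assms in auto)
  finally show ?thesis .
qed

section \<open>The fractional kernel and its tail mass\<close>

text \<open>The value at the origin is \<open>0\<close>, since \<open>0 powr\<close> anything is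
  \<open>0\<close>. This agrees with the convention that division by zero gives zero, so no diagonal
  case arises when the definitions of \<open>gagliardo_integrand\<close> and \<open>C_const\<close>
  are rewritten with this kernel.\<close>

definition frac_ker :: "real \<Rightarrow> 'a::euclidean_space \<Rightarrow> real" where
  "frac_ker r z = norm z powr - (real DIM('a) + 2 * r)"

definition tail_mass :: "'a::euclidean_space itself \<Rightarrow> real \<Rightarrow> real \<Rightarrow> real" where
  "tail_mass _ r d = (\<integral>z. frac_ker r z * indicator {z::'a. d \<le> norm z} z \<partial>lborel)"

text \<open>For \<open>r\<close> at most 1/2 and \<open>norm z\<close> at most 1, this integrand
  dominates \<open>(norm z)\<^sup>2 * frac_ker r z\<close>. Its exponent is free of
  \<open>r\<close>, so it bounds the singular part of every integral below uniformly as
  \<open>r\<close> tends to 0.\<close>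

definition near_mass :: "'a::euclidean_space itself \<Rightarrow> real" where
  "near_mass _ = (\<integral>z. norm z powr - (real DIM('a) - 1) * indicator (cball 0 1) (z::'a) \<partial>lborel)"

lemma frac_ker_nonneg [simp]: "frac_ker r z \<ge> 0"
  by (simp add: frac_ker_def)

lemma frac_ker_minus_commute: "frac_ker r (x - y) = frac_ker r (y - x)"
  by (simp add: frac_ker_def norm_minus_commute)

lemma borel_measurable_frac_ker [measurable]: "frac_ker r \<in> borel_measurable borel"
  unfolding frac_ker_def by measurable

lemma integrable_frac_ker_tail_one:
  assumes "r > 0"
  shows "integrable lborel (\<lambda>z. frac_ker r z * indicator {z::'a::euclidean_space. 1 \<le> norm z} z)"
  using nn_integral_powr_tail_finite[where p = "real DIM('a) + 2 * r" and 'a = 'a] assms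
  by (intro integrableI_nonneg)
     (auto simp: frac_ker_def[abs_def] ennreal_mult ennreal_indicator zero_less_mult_iff)

lemma nn_integral_frac_ker_tail:
  assumes "r > 0" "d > 0"
  shows "(\<integral>\<^sup>+z. ennreal (frac_ker r z * indicator {z::'a::euclidean_space. d \<le> norm z} z) \<partial>lborel) =
    ennreal (d powr (- 2 * r) * tail_mass TYPE('a) r 1)"
proof -
  have "(\<integral>\<^sup>+z. ennreal (frac_ker r z * indicator {z::'a. d \<le> norm z} z) \<partial>lborel) =
    (\<integral>\<^sup>+z. ennreal (norm z powr - (real DIM('a) + 2 * r)) * indicator {z::'a. 1 \<le> norm z} (z /\<^sub>R d) \<partial>lborel)"
    using assms
    by (intro nn_integral_cong) (auto simp: frac_ker_def indicator_def field_simps)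
  also have "\<dots> = ennreal (d powr (- 2 * r)) *
      (\<integral>\<^sup>+z. ennreal (norm z powr - (real DIM('a) + 2 * r)) * indicator {z::'a. 1 \<le> norm z} z \<partial>lborel)"
    using assms by (subst nn_integral_powr_scale) auto
  also have "(\<integral>\<^sup>+z. ennreal (norm z powr - (real DIM('a) + 2 * r)) * indicator {z::'a. 1 \<le> norm z} z \<partial>lborel)
     = (\<integral>\<^sup>+z. ennreal (frac_ker r z * indicator {z::'a. 1 \<le> norm z} z) \<partial>lborel)"
    by (intro nn_integral_cong) (auto simp: frac_ker_def indicator_def)
  also have "\<dots> = ennreal (tail_mass TYPE('a) r 1)"
    unfolding tail_mass_def using assms
    by (intro nn_integral_eq_integral integrable_frac_ker_tail_one) auto
  finally show ?thesis by (simp add: ennreal_mult')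
qed

lemma
  assumes "r > 0" "d > 0"
  shows integrable_frac_ker_tail:
      "integrable lborel (\<lambda>z. frac_ker r z * indicator {z::'a::euclidean_space. d \<le> norm z} z)"
    and tail_mass_scale: "tail_mass TYPE('a) r d = d powr (- 2 * r) * tail_mass TYPE('a) r 1"
proof -
  show "integrable lborel (\<lambda>z. frac_ker r z * indicator {z::'a. d \<le> norm z} z)"
    using nn_integral_frac_ker_tail[OF assms, where 'a = 'a]
    by (intro integrableI_nonneg) auto
  have "tail_mass TYPE('a) r 1 \<ge> 0" unfolding tail_mass_def by (intro Bochner_Integration.integral_nonneg) auto
  then show "tail_mass TYPE('a) r d = d powr (- 2 * r) * tail_mass TYPE('a) r 1"
    unfolding tail_mass_def[of _ r d]
    by (subst integral_eq_nn_integral) (auto simp: nn_integral_frac_ker_tail[OF assms])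
qed

lemma tail_mass_nonneg: "tail_mass T r d \<ge> 0"
  unfolding tail_mass_def by (intro Bochner_Integration.integral_nonneg) auto

text \<open>By scaling, the mass between radii 1 and 2 is \<open>1 - 2 powr (- 2 * r)\<close> times
  the whole tail mass. It is at least \<open>c\<close> uniformly in \<open>r\<close>: the ball of
  radius 1/2 about \<open>(3/2) *\<^sub>R b\<close> lies in that annulus, and there the kernel is at
  least \<open>2 powr - (DIM('a) + 2)\<close>. Since the factor tends to 0 with \<open>r\<close>,
  the tail mass must blow up.\<close>

lemma tail_mass_lower:
  "\<exists>c>0. \<forall>r. 0 < r \<and> r \<le> 1 \<longrightarrow> c / (1 - 2 powr (- 2 * r)) \<le> tail_mass TYPE('a::euclidean_space) r 1"
proof -
  obtain b :: 'a where b: "b \<in> Basis" using nonempty_Basis by blast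
  define c where "c = 2 powr - (real DIM('a) + 2) * measure lborel (ball ((3/2) *\<^sub>R b) (1/2))"
  have "c > 0" unfolding c_def by (simp add: content_ball_pos)
  moreover have "c / (1 - 2 powr (- 2 * r)) \<le> tail_mass TYPE('a) r 1" if r: "0 < r" "r \<le> 1" for r
  proof -
    have pt: "2 powr - (real DIM('a) + 2) * indicator (ball ((3/2) *\<^sub>R b) (1/2)) z \<le>
       frac_ker r z * indicator {z::'a. 1 \<le> norm z} z - frac_ker r z * indicator {z::'a. 2 \<le> norm z} z" for z
    proof (cases "z \<in> ball ((3/2) *\<^sub>R b) (1/2)")
      case True
      then have d: "norm ((3/2) *\<^sub>R b - z) < 1/2" by (simp add: dist_norm)
      have n: "norm ((3/2) *\<^sub>R b) = 3/2" using b by simp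
      have "1 < norm z" "norm z < 2"
        using d n norm_triangle_sub[of "(3/2) *\<^sub>R b" z] norm_triangle_sub[of z "(3/2) *\<^sub>R b"]
        by (auto simp: norm_minus_commute)
      moreover from this have "2 powr - (real DIM('a) + 2) \<le> 2 powr - (real DIM('a) + 2 * r)"
        using r by (intro powr_mono) auto
      moreover have "2 powr - (real DIM('a) + 2 * r) \<le> frac_ker r z"
        unfolding frac_ker_def using \<open>1 < norm z\<close> \<open>norm z < 2\<close> r by (intro powr_mono2') auto
      ultimately have "2 powr - (real DIM('a) + 2) \<le> frac_ker r z" by linarith
      then show ?thesis using True \<open>1 < norm z\<close> \<open>norm z < 2\<close> by simp
    qed (auto simp: indicator_def)
    have "c = (\<integral>z. 2 powr - (real DIM('a) + 2) * indicator (ball ((3/2) *\<^sub>R b) (1/2)) z \<partial>lborel)"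
      by (simp add: c_def)
    also have "\<dots> \<le> (\<integral>z. frac_ker r z * indicator {z::'a. 1 \<le> norm z} z -
                        frac_ker r z * indicator {z::'a. 2 \<le> norm z} z \<partial>lborel)"
      using r pt emeasure_lborel_ball_finite
      by (intro integral_mono Bochner_Integration.integrable_diff integrable_frac_ker_tail)
         (auto intro!: integrable_real_indicator)
    also have "\<dots> = tail_mass TYPE('a) r 1 - tail_mass TYPE('a) r 2"
      unfolding tail_mass_def using r
      by (intro Bochner_Integration.integral_diff integrable_frac_ker_tail) auto
    also have "\<dots> = tail_mass TYPE('a) r 1 * (1 - 2 powr (- 2 * r))"
      using r by (subst tail_mass_scale[of r 2]) (auto simp: algebra_simps)
    finally show ?thesis using r by (simp add: field_simps powr_less_one)
  qed
  ultimately show ?thesis by blast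
qed

lemma tail_mass_at_top:
  "filterlim (\<lambda>r. tail_mass TYPE('a::euclidean_space) r 1) at_top (at_right 0)"
proof -
  obtain c where "c > 0" and c: "\<And>r. 0 < r \<Longrightarrow> r \<le> 1 \<Longrightarrow> c / (1 - 2 powr (- 2 * r)) \<le> tail_mass TYPE('a) r 1"
    using tail_mass_lower by blast
  have "filterlim (\<lambda>r::real. c / (1 - 2 powr (- 2 * r))) at_top (at_right 0)"
    using \<open>c > 0\<close> by real_asymp
  moreover have "\<forall>\<^sub>F r in at_right 0. c / (1 - 2 powr (- 2 * r)) \<le> tail_mass TYPE('a) r 1"
    using eventually_at_right_real[OF zero_less_one] by eventually_elim (use c in auto)
  ultimately show ?thesis by (rule filterlim_at_top_mono)
qed

lemma integrable_near:
  "integrable lborel (\<lambda>z. norm z powr - (real DIM('a) - 1) * indicator (cball 0 1) (z::'a::euclidean_space))"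
proof -
  have [measurable]: "cball (0::'a) 1 \<in> sets borel" by simp
  have "0 \<le> real DIM('a) - 1" by (simp add: Suc_leI)
  then show ?thesis
    using nn_integral_powr_near_finite[where p = "real DIM('a) - 1" and 'a = 'a]
    by (intro integrableI_nonneg) (simp_all add: ennreal_mult ennreal_indicator)
qed

lemma sq_frac_ker_le:
  fixes z :: "'a::euclidean_space"
  assumes "r \<le> 1/2" "norm z \<le> 1"
  shows "(norm z)\<^sup>2 * frac_ker r z \<le> norm z powr - (real DIM('a) - 1)"
proof (cases "z = 0")
  case False
  then have "(norm z)\<^sup>2 * frac_ker r z = norm z powr (2 - (real DIM('a) + 2 * r))"
    by (simp add: frac_ker_def powr_diff powr_minus_divide powr_add)
  also have "\<dots> \<le> norm z powr - (real DIM('a) - 1)"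
    using assms False by (intro powr_mono') auto
  finally show ?thesis by (simp add: of_nat_diff Suc_leI)
qed (simp add: frac_ker_def)

section \<open>Asymptotics of the normalising constant\<close>

lemma integrable_bounded_mult_frac_ker_tail:
  fixes g :: "'a::euclidean_space \<Rightarrow> real"
  assumes "r > 0" "d > 0" and [measurable]: "g \<in> borel_measurable borel" and "\<And>z. \<bar>g z\<bar> \<le> B"
  shows "integrable lborel (\<lambda>z. g z * (frac_ker r z * indicator {z. d \<le> norm z} z))"
proof (rule Bochner_Integration.integrable_bound)
  show "integrable lborel (\<lambda>z::'a. B * (frac_ker r z * indicator {z. d \<le> norm z} z))"
    using assms by (intro integrable_mult_right integrable_frac_ker_tail)
  have "B \<ge> 0" using order_trans[OF abs_ge_zero assms(4)] .
  then show "AE z in lborel. norm (g z * (frac_ker r z * indicator {z. d \<le> norm z} z))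
      \<le> norm (B * (frac_ker r z * indicator {z. d \<le> norm z} z))"
    using assms(4) by (auto simp: abs_mult intro!: mult_right_mono)
qed measurable

text \<open>A shift of length \<open>pi\<close> enlarges a norm that is at least \<open>R\<close> by
  at most the factor \<open>1 + pi / R\<close>. The second claim keeps the shifted point inside the
  region of integration.\<close>

lemma frac_ker_shift_lower:
  fixes z e :: "'a::euclidean_space"
  assumes "r > 0" "norm e = pi" "R \<ge> 1 + pi" "R \<le> norm z"
  shows "(1 + pi / R) powr - (real DIM('a) + 2 * r) * frac_ker r z \<le> frac_ker r (e + z)"
    and "1 \<le> norm (e + z)"
proof -
  show *: "1 \<le> norm (e + z)" using norm_triangle_ineq2[of z "-e"] assms by (auto simp: add.commute)
  have R: "R > 0" using assms pi_gt_zero by linarith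
  have "norm (e + z) \<le> pi + norm z" using norm_triangle_ineq[of e z] assms by simp
  also have "\<dots> \<le> (1 + pi / R) * norm z"
    using assms R by (simp add: field_simps)
  finally have "norm (e + z) \<le> (1 + pi / R) * norm z" .
  then have "((1 + pi / R) * norm z) powr - (real DIM('a) + 2 * r) \<le> norm (e + z) powr - (real DIM('a) + 2 * r)"
    using * assms by (intro powr_mono2') auto
  then show "(1 + pi / R) powr - (real DIM('a) + 2 * r) * frac_ker r z \<le> frac_ker r (e + z)"
    using R unfolding frac_ker_def by (simp add: powr_mult)
qed

text \<open>Shifting by \<open>\<pi>\<close> along \<open>b\<close> flips the sign of the cosine but barely changes the
  kernel far out.\<close>

lemma tail_integral_cos_flip:
  fixes b :: "'a::euclidean_space"
  assumes "r > 0" and b: "norm b = 1" and R: "R \<ge> 1 + pi" and s: "\<bar>s\<bar> = 1"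
  defines "G \<equiv> \<lambda>z::'a. frac_ker r z * indicator {z. 1 \<le> norm z} z"
  shows "(1 + pi / R) powr - (real DIM('a) + 2 * r) *
      ((\<integral>z. (1 - s * cos (z \<bullet> b)) * G z \<partial>lborel) -
        2 * (1 - R powr (- 2 * r)) * tail_mass TYPE('a) r 1)
    \<le> (\<integral>z. (1 + s * cos (z \<bullet> b)) * G z \<partial>lborel)"
proof -
  define \<rho> where "\<rho> = (1 + pi / R) powr - (real DIM('a) + 2 * r)"
  define e where "e = pi *\<^sub>R b"
  define H where "H = (\<lambda>z::'a. frac_ker r z * indicator {z. R \<le> norm z} z)"
  have R0: "R > 1" using R pi_gt_zero by linarith
  have e: "norm e = pi" using b by (simp add: e_def)
  have [measurable]: "G \<in> borel_measurable borel" unfolding G_def by measurable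
  have G0: "G z \<ge> 0" for z by (simp add: G_def)
  have H0: "H z \<ge> 0" for z by (simp add: H_def)
  have scos: "\<bar>s * cos t\<bar> \<le> 1" for t using s by (simp add: abs_mult)
  have bd: "\<bar>1 - s * cos t\<bar> \<le> 2" "\<bar>1 + s * cos t\<bar> \<le> 2" "0 \<le> 1 - s * cos t" "1 - s * cos t \<le> 2" for t
    using scos[of t] by (auto simp: abs_le_iff)
  have cos_e: "cos ((e + z) \<bullet> b) = - cos (z \<bullet> b)" for z
  proof -
    have "(e + z) \<bullet> b = z \<bullet> b + pi"
      using b by (simp add: e_def inner_add_left dot_square_norm)
    then show ?thesis by (simp only: cos_periodic_pi)
  qed
  have iG: "integrable lborel (\<lambda>z. g z * G z)"
    if [measurable]: "g \<in> borel_measurable borel" and "\<And>z. \<bar>g z\<bar> \<le> 2" for g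
    unfolding G_def using assms(1) that by (intro integrable_bounded_mult_frac_ker_tail) auto
  have iH: "integrable lborel (\<lambda>z. g z * H z)"
    if [measurable]: "g \<in> borel_measurable borel" and "\<And>z. \<bar>g z\<bar> \<le> 2" for g
    unfolding H_def using assms(1) that R0 by (intro integrable_bounded_mult_frac_ker_tail) auto
  have iG1: "integrable lborel G" using iG[of "\<lambda>_. 1"] by simp
  have iH1: "integrable lborel H" using iH[of "\<lambda>_. 1"] by simp
  have iP: "integrable lborel (\<lambda>z. (1 + s * cos (z \<bullet> b)) * G z)" by (rule iG) (use bd in auto)
  have iQ: "integrable lborel (\<lambda>z. (1 - s * cos (z \<bullet> b)) * G z)" by (rule iG) (use bd in auto)
  have iQH: "integrable lborel (\<lambda>z. (1 - s * cos (z \<bullet> b)) * H z)" by (rule iH) (use bd in auto)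
  have shift: "integral\<^sup>L lborel f = (\<integral>z. f (e + z) \<partial>lborel)"
      and shift_int: "integrable lborel f \<Longrightarrow> integrable lborel (\<lambda>z. f (e + z))"
    if [measurable]: "f \<in> borel_measurable borel" for f :: "'a \<Rightarrow> real"
    using integral_distr[of "(+) e" lborel borel f] integrable_distr[of "(+) e" lborel borel f]
    by (auto simp: lborel_distr_plus)
  \<comment> \<open>The mass of the kernel between radii 1 and \<open>R\<close> is
    \<open>1 - R powr (- 2 * r)\<close> times the tail mass. The weight \<open>1 - s * cos\<close>
    is at most 2, so subtracting twice that mass leaves at most the integral over
    \<open>norm z\<close> at least \<open>R\<close>.\<close>
  have "(\<integral>z. (1 - s * cos (z \<bullet> b)) * G z \<partial>lborel) - 2 * (1 - R powr (- 2 * r)) * tail_mass TYPE('a) r 1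
      = (\<integral>z. (1 - s * cos (z \<bullet> b)) * G z - 2 * (G z - H z) \<partial>lborel)"
  proof -
    have "integral\<^sup>L lborel H = R powr (- 2 * r) * integral\<^sup>L lborel G"
      using tail_mass_scale[of r R, where 'a='a] assms(1) R0 unfolding tail_mass_def G_def H_def by simp
    moreover have "tail_mass TYPE('a) r 1 = integral\<^sup>L lborel G"
      by (simp add: tail_mass_def G_def)
    moreover have "(\<integral>z. (1 - s * cos (z \<bullet> b)) * G z - 2 * (G z - H z) \<partial>lborel) =
        (\<integral>z. (1 - s * cos (z \<bullet> b)) * G z \<partial>lborel) - 2 * (integral\<^sup>L lborel G - integral\<^sup>L lborel H)"
      using iQ iG1 iH1 by (subst Bochner_Integration.integral_diff) auto
    ultimately show ?thesis by (simp add: left_diff_distrib right_diff_distrib)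
  qed
  also have "\<dots> \<le> (\<integral>z. (1 - s * cos (z \<bullet> b)) * H z \<partial>lborel)"
  proof (rule integral_mono)
    fix z :: 'a
    have "H z \<le> G z" using R0 by (auto simp: G_def H_def indicator_def)
    then have "0 \<le> (2 - (1 - s * cos (z \<bullet> b))) * (G z - H z)"
      using bd(4)[of "z \<bullet> b"] by (intro mult_nonneg_nonneg) linarith+
    then show "(1 - s * cos (z \<bullet> b)) * G z - 2 * (G z - H z) \<le> (1 - s * cos (z \<bullet> b)) * H z"
      by (simp add: algebra_simps)
  qed (use iQ iG1 iH1 iQH in auto)
  finally have "\<rho> * ((\<integral>z. (1 - s * cos (z \<bullet> b)) * G z \<partial>lborel) -
        2 * (1 - R powr (- 2 * r)) * tail_mass TYPE('a) r 1) \<le>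
       \<rho> * (\<integral>z. (1 - s * cos (z \<bullet> b)) * H z \<partial>lborel)"
    by (intro mult_left_mono) (auto simp: \<rho>_def)
  also have "\<dots> = (\<integral>z. \<rho> * ((1 - s * cos (z \<bullet> b)) * H z) \<partial>lborel)" by simp
  \<comment> \<open>At the shifted point the weight \<open>1 - s * cos\<close> has become
    \<open>1 + s * cos\<close>, and the kernel has lost at most the factor \<open>\<rho>\<close>.
    Translation invariance then removes the shift.\<close>
  also have "\<dots> \<le> (\<integral>z. (1 + s * cos ((e + z) \<bullet> b)) * G (e + z) \<partial>lborel)"
  proof (rule integral_mono)
    show "integrable lborel (\<lambda>z. \<rho> * ((1 - s * cos (z \<bullet> b)) * H z))" using iQH by simp
    show "integrable lborel (\<lambda>z. (1 + s * cos ((e + z) \<bullet> b)) * G (e + z))"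
      using shift_int[OF _ iP] by simp
    fix z :: 'a
    have "\<rho> * H z \<le> G (e + z)"
      using frac_ker_shift_lower[of r e R z] assms(1) e R
      by (auto simp: G_def H_def \<rho>_def indicator_def)
    then have "(1 - s * cos (z \<bullet> b)) * (\<rho> * H z) \<le> (1 - s * cos (z \<bullet> b)) * G (e + z)"
      using bd by (intro mult_left_mono) auto
    then show "\<rho> * ((1 - s * cos (z \<bullet> b)) * H z) \<le> (1 + s * cos ((e + z) \<bullet> b)) * G (e + z)"
      by (simp add: cos_e mult_ac)
  qed
  also have "\<dots> = (\<integral>z. (1 + s * cos (z \<bullet> b)) * G z \<partial>lborel)"
    by (rule shift[symmetric]) simp
  finally show ?thesis unfolding \<rho>_def .
qed

text \<open>Let \<open>P\<close> be the tail integral with weight \<open>1 + cos\<close>, so that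
  \<open>P + M = 2 * J\<close>. The flip inequality with sign 1 bounds \<open>P\<close> below by
  \<open>M\<close>, and with sign -1 it bounds \<open>M\<close> below by \<open>P\<close>, up to the
  errors \<open>\<rho>\<close> and \<open>\<theta>\<close>. Eliminating \<open>P\<close> traps
  \<open>M / J\<close> between two expressions that tend to 1 as \<open>\<rho>\<close> tends to 1
  and \<open>\<theta>\<close> to 0.\<close>

lemma tail_integral_cos_bounds:
  fixes b :: "'a::euclidean_space"
  assumes "r > 0" "norm b = 1" "R \<ge> 1 + pi"
  defines "M \<equiv> (\<integral>z. (1 - cos (z \<bullet> b)) * (frac_ker r z * indicator {z::'a. 1 \<le> norm z} z) \<partial>lborel)"
    and "J \<equiv> tail_mass TYPE('a) r 1"
    and "\<rho> \<equiv> (1 + pi / R) powr - (real DIM('a) + 2 * r)" and "\<theta> \<equiv> 1 - R powr (- 2 * r)"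
  shows "2 * \<rho> * (1 - \<theta>) / (1 + \<rho>) * J \<le> M" "M \<le> (2 + 2 * \<rho> * \<theta>) / (1 + \<rho>) * J"
proof -
  define P where "P = (\<integral>z. (1 + cos (z \<bullet> b)) * (frac_ker r z * indicator {z::'a. 1 \<le> norm z} z) \<partial>lborel)"
  have bd: "\<bar>1 - cos t\<bar> \<le> 2" "\<bar>1 + cos t\<bar> \<le> 2" for t :: real
    using cos_le_one[of t] cos_ge_minus_one[of t] by linarith+
  have "P + M = (\<integral>z. (1 + cos (z \<bullet> b)) * (frac_ker r z * indicator {z::'a. 1 \<le> norm z} z) +
      (1 - cos (z \<bullet> b)) * (frac_ker r z * indicator {z::'a. 1 \<le> norm z} z) \<partial>lborel)"
    unfolding P_def M_def using assms(1) bd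
    by (intro Bochner_Integration.integral_add[symmetric] integrable_bounded_mult_frac_ker_tail[where B = 2]) auto
  also have "\<dots> = 2 * J" unfolding J_def tail_mass_def
    by (simp add: algebra_simps flip: Bochner_Integration.integral_mult_right_zero)
  finally have PM: "P = 2 * J - M" by simp
  have "\<rho> * (M - 2 * \<theta> * J) \<le> P"
    using tail_integral_cos_flip[of r b R 1] assms(1-3)
    by (simp add: M_def P_def J_def \<rho>_def \<theta>_def)
  moreover have "\<rho> * (P - 2 * \<theta> * J) \<le> M"
    using tail_integral_cos_flip[of r b R "-1"] assms(1-3)
    by (simp add: M_def P_def J_def \<rho>_def \<theta>_def)
  moreover have "1 + \<rho> > 0" by (simp add: \<rho>_def add_pos_nonneg)
  ultimately show "2 * \<rho> * (1 - \<theta>) / (1 + \<rho>) * J \<le> M" "M \<le> (2 + 2 * \<rho> * \<theta>) / (1 + \<rho>) * J"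
    unfolding PM by (auto simp: divide_simps algebra_simps)
qed

text \<open>Inside the unit ball \<open>1 - cos (z \<bullet> b)\<close> is at most
  \<open>(norm z)\<^sup>2\<close>, which cancels enough of the singularity for
  \<open>near_mass\<close> to dominate. The tail integral thus differs from the full one by a
  constant independent of \<open>r\<close>.\<close>

lemma integral_cos_frac_ker_bounds:
  fixes b :: "'a::euclidean_space"
  assumes "0 < r" "r \<le> 1/2" "norm b = 1"
  defines "M \<equiv> (\<integral>z. (1 - cos (z \<bullet> b)) * (frac_ker r z * indicator {z::'a. 1 \<le> norm z} z) \<partial>lborel)"
    and "I \<equiv> (\<integral>z. (1 - cos (z \<bullet> b)) * frac_ker r z \<partial>lborel)"
  shows "M \<le> I" "I \<le> M + near_mass TYPE('a)"
proof -
  have bd: "\<bar>1 - cos t\<bar> \<le> 2" "0 \<le> 1 - cos t" for t :: real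
    using cos_le_one[of t] cos_ge_minus_one[of t] by linarith+
  have iM: "integrable lborel (\<lambda>z. (1 - cos (z \<bullet> b)) * (frac_ker r z * indicator {z::'a. 1 \<le> norm z} z))"
    using assms(1) bd by (intro integrable_bounded_mult_frac_ker_tail[where B = 2]) auto
  have le: "(1 - cos (z \<bullet> b)) * frac_ker r z \<le>
      (1 - cos (z \<bullet> b)) * (frac_ker r z * indicator {z::'a. 1 \<le> norm z} z) +
      norm z powr - (real DIM('a) - 1) * indicator (cball 0 1) z" for z
  proof (cases "1 \<le> norm z")
    case False
    have "1 - cos (z \<bullet> b) = 2 * (sin (z \<bullet> b / 2))\<^sup>2"
      using cos_double_sin[of "z \<bullet> b / 2"] by simp
    also have "(sin (z \<bullet> b / 2))\<^sup>2 \<le> (z \<bullet> b / 2)\<^sup>2"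
      using abs_sin_x_le_abs_x by (simp add: abs_le_square_iff)
    also have "(z \<bullet> b / 2)\<^sup>2 = (z \<bullet> b)\<^sup>2 / 4" by (simp add: power_divide)
    also have "(z \<bullet> b)\<^sup>2 \<le> (norm z)\<^sup>2"
      using Cauchy_Schwarz_ineq2[of z b] assms(3) by (simp flip: abs_le_square_iff)
    finally have "1 - cos (z \<bullet> b) \<le> (norm z)\<^sup>2"
      using zero_le_power2[of "norm z"] by linarith
    then have "(1 - cos (z \<bullet> b)) * frac_ker r z \<le> (norm z)\<^sup>2 * frac_ker r z"
      by (rule mult_right_mono) simp
    also have "\<dots> \<le> norm z powr - (real DIM('a) - 1)"
      using False assms by (intro sq_frac_ker_le) auto
    finally show ?thesis using False by simp
  qed simp
  have iI: "integrable lborel (\<lambda>z. (1 - cos (z \<bullet> b)) * frac_ker r z)"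
  proof (rule Bochner_Integration.integrable_bound)
    show "integrable lborel (\<lambda>z. (1 - cos (z \<bullet> b)) * (frac_ker r z * indicator {z::'a. 1 \<le> norm z} z) +
      norm z powr - (real DIM('a) - 1) * indicator (cball 0 1) z)"
      by (intro Bochner_Integration.integrable_add iM integrable_near)
    show "AE z in lborel. norm ((1 - cos (z \<bullet> b)) * frac_ker r z) \<le>
       norm ((1 - cos (z \<bullet> b)) * (frac_ker r z * indicator {z::'a. 1 \<le> norm z} z) +
      norm z powr - (real DIM('a) - 1) * indicator (cball 0 1) z)"
      using order_trans[OF le abs_ge_self] bd by (auto simp: abs_mult)
  qed measurable
  show "M \<le> I" unfolding M_def I_def
    by (intro integral_mono iM iI mult_left_mono bd) (auto simp: indicator_def)
  have "I \<le> (\<integral>z. (1 - cos (z \<bullet> b)) * (frac_ker r z * indicator {z::'a. 1 \<le> norm z} z) +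
      norm z powr - (real DIM('a) - 1) * indicator (cball 0 1) z \<partial>lborel)"
    unfolding I_def by (intro integral_mono iI Bochner_Integration.integrable_add iM integrable_near le)
  also have "\<dots> = M + near_mass TYPE('a)"
    unfolding M_def near_mass_def by (intro Bochner_Integration.integral_add iM integrable_near)
  finally show "I \<le> M + near_mass TYPE('a)" .
qed

lemma near_mass_nonneg: "near_mass T \<ge> 0"
  unfolding near_mass_def by (intro Bochner_Integration.integral_nonneg) auto

lemma integral_cos_frac_ker_asymptotic:
  fixes b :: "'a::euclidean_space"
  assumes b: "norm b = 1"
  shows "((\<lambda>r. (\<integral>z. (1 - cos (z \<bullet> b)) * frac_ker r z \<partial>lborel) / tail_mass TYPE('a) r 1) \<longlongrightarrow> 1) (at_right 0)"
proof -
  define N where "N = real DIM('a)"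
  have "N > 0" by (simp add: N_def)
  \<comment> \<open>The cutoff is \<open>R = 1 / r\<close>. It tends to infinity, so
    \<open>\<rho>\<close> tends to 1, yet slowly enough that \<open>R powr (- 2 * r)\<close> still
    tends to 1 and \<open>\<theta>\<close> to 0.\<close>
  define \<rho> where "\<rho> = (\<lambda>r::real. (1 + pi * r) powr - (N + 2 * r))"
  define \<theta> where "\<theta> = (\<lambda>r::real. 1 - (1 / r) powr (- 2 * r))"
  define J where "J = (\<lambda>r. tail_mass TYPE('a) r 1)"
  define I where "I = (\<lambda>r. \<integral>z. (1 - cos (z \<bullet> b)) * frac_ker r z \<partial>lborel)"
  have \<rho>: "(\<rho> \<longlongrightarrow> 1) (at_right 0)" unfolding \<rho>_def by real_asymp
  have \<theta>: "(\<theta> \<longlongrightarrow> 0) (at_right 0)" unfolding \<theta>_def by real_asymp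
  have J: "filterlim J at_top (at_right 0)" unfolding J_def by (rule tail_mass_at_top)
  have "(1 + pi) > (0::real)" using pi_gt_zero by linarith
  then have "0 < min (1 / (1 + pi)) (1 / 2 :: real)" by simp
  then have "\<forall>\<^sub>F r in at_right 0. r \<in> {0<..<min (1 / (1 + pi)) (1/2)}"
    by (rule eventually_at_right_real)
  moreover have "\<forall>\<^sub>F r in at_right 0. J r > 0"
    using J by (simp add: filterlim_at_top_dense)
  ultimately have ev: "\<forall>\<^sub>F r in at_right 0. 2 * \<rho> r * (1 - \<theta> r) / (1 + \<rho> r) \<le> I r / J r \<and>
     I r / J r \<le> (2 + 2 * \<rho> r * \<theta> r) / (1 + \<rho> r) + near_mass TYPE('a) / J r"
  proof eventually_elim
    case (elim r)
    then have r: "0 < r" "r \<le> 1/2" "1 / r \<ge> 1 + pi"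
      using \<open>1 + pi > 0\<close> by (auto simp: field_simps)
    define M where "M = (\<integral>z. (1 - cos (z \<bullet> b)) * (frac_ker r z * indicator {z::'a. 1 \<le> norm z} z) \<partial>lborel)"
    have "2 * \<rho> r * (1 - \<theta> r) / (1 + \<rho> r) * J r \<le> M" "M \<le> (2 + 2 * \<rho> r * \<theta> r) / (1 + \<rho> r) * J r"
      using tail_integral_cos_bounds[of r b "1 / r"] r b
      by (simp_all add: \<rho>_def \<theta>_def J_def M_def N_def)
    moreover have "M \<le> I r" "I r \<le> M + near_mass TYPE('a)"
      unfolding M_def I_def using r b by (auto intro!: integral_cos_frac_ker_bounds)
    ultimately have "2 * \<rho> r * (1 - \<theta> r) / (1 + \<rho> r) * J r \<le> I r"
      "I r \<le> (2 + 2 * \<rho> r * \<theta> r) / (1 + \<rho> r) * J r + near_mass TYPE('a)"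
      by linarith+
    then show ?case using elim(2) by (simp add: pos_le_divide_eq pos_divide_le_eq distrib_right)
  qed
  have "((\<lambda>r. I r / J r) \<longlongrightarrow> 1) (at_right 0)"
  proof (rule tendsto_sandwich)
    have "((\<lambda>r. 2 * \<rho> r * (1 - \<theta> r) / (1 + \<rho> r)) \<longlongrightarrow> 2 * 1 * (1 - 0) / (1 + 1)) (at_right 0)"
      by (intro tendsto_intros \<rho> \<theta>) simp
    then show "((\<lambda>r. 2 * \<rho> r * (1 - \<theta> r) / (1 + \<rho> r)) \<longlongrightarrow> 1) (at_right 0)" by simp
    have "((\<lambda>r. near_mass TYPE('a) / J r) \<longlongrightarrow> 0) (at_right 0)"
      by (rule real_tendsto_divide_at_top[OF tendsto_const J])
    then have "((\<lambda>r. (2 + 2 * \<rho> r * \<theta> r) / (1 + \<rho> r) + near_mass TYPE('a) / J r) \<longlongrightarrow>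
        (2 + 2 * 1 * 0) / (1 + 1) + 0) (at_right 0)"
      by (intro tendsto_intros \<rho> \<theta>) simp_all
    then show "((\<lambda>r. (2 + 2 * \<rho> r * \<theta> r) / (1 + \<rho> r) + near_mass TYPE('a) / J r) \<longlongrightarrow> 1) (at_right 0)"
      by simp
  qed (use ev in \<open>auto elim: eventually_mono\<close>)
  then show ?thesis by (simp add: I_def J_def)
qed

section \<open>The energy\<close>

text \<open>This is the squared Gagliardo seminorm with values up to infinity, so Tonelli's theorem,
  Fatou's lemma and comparison arguments apply without integrability conditions.\<close>

definition energy :: "real \<Rightarrow> ('a::euclidean_space \<Rightarrow> real) \<Rightarrow> ennreal" where
  "energy r v = (\<integral>\<^sup>+x. \<integral>\<^sup>+y. ennreal ((v x - v y)\<^sup>2 * frac_ker r (x - y)) \<partial>lborel \<partial>lborel)"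

text \<open>Integrate the term with \<open>f x\<close> first in \<open>y\<close> and the term with
  \<open>f y\<close> first in \<open>x\<close>. The truncated kernel is even and translation
  invariant, so each inner integral is the tail mass.\<close>

lemma nn_integral_tail_convolution:
  fixes f :: "'a::euclidean_space \<Rightarrow> real"
  assumes "r > 0" "d > 0" and [measurable]: "f \<in> borel_measurable borel" and f: "\<And>x. f x \<ge> 0"
  shows "(\<integral>\<^sup>+x. \<integral>\<^sup>+y. ennreal ((f x + f y) * (frac_ker r (x - y) * indicator {z. d \<le> norm z} (x - y))) \<partial>lborel \<partial>lborel)
    = ennreal (2 * tail_mass TYPE('a) r d) * (\<integral>\<^sup>+x. ennreal (f x) \<partial>lborel)"
proof -
  define K where "K = (\<lambda>z::'a. frac_ker r z * indicator {z. d \<le> norm z} z)"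
  define T where "T = ennreal (tail_mass TYPE('a) r d)"
  have [measurable]: "K \<in> borel_measurable borel" unfolding K_def by measurable
  have K0: "K z \<ge> 0" for z by (simp add: K_def)
  have K_comm: "K (x - y) = K (y - x)" for x y
    by (simp add: K_def frac_ker_minus_commute[of r x y] norm_minus_commute[of x y] indicator_def)
  have "(\<integral>\<^sup>+y. ennreal (K (x - y)) \<partial>lborel) = (\<integral>\<^sup>+y. ennreal (K y) \<partial>lborel)" for x
    by (rule nn_integral_lborel_reflect) measurable
  also have "(\<integral>\<^sup>+y. ennreal (K y) \<partial>lborel) = T"
    unfolding K_def T_def using nn_integral_frac_ker_tail[OF assms(1,2), where 'a='a]
      tail_mass_scale[OF assms(1,2), where 'a='a] by simp
  finally have T: "(\<integral>\<^sup>+y. ennreal (K (x - y)) \<partial>lborel) = T" for x .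
  have 1: "(\<integral>\<^sup>+x. \<integral>\<^sup>+y. ennreal (f x) * ennreal (K (x - y)) \<partial>lborel \<partial>lborel) = T * (\<integral>\<^sup>+x. ennreal (f x) \<partial>lborel)"
    by (simp add: nn_integral_cmult T nn_integral_multc mult.commute)
  have "(\<integral>\<^sup>+x. \<integral>\<^sup>+y. ennreal (f y) * ennreal (K (x - y)) \<partial>lborel \<partial>lborel) =
     (\<integral>\<^sup>+y. \<integral>\<^sup>+x. ennreal (f y) * ennreal (K (x - y)) \<partial>lborel \<partial>lborel)"
    by (rule lborel_pair.Fubini') measurable
  also have "\<dots> = (\<integral>\<^sup>+y. \<integral>\<^sup>+x. ennreal (f y) * ennreal (K (y - x)) \<partial>lborel \<partial>lborel)"
    by (intro nn_integral_cong, subst K_comm, rule refl)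
  also have "\<dots> = T * (\<integral>\<^sup>+x. ennreal (f x) \<partial>lborel)" by (rule 1)
  finally have 2: "(\<integral>\<^sup>+x. \<integral>\<^sup>+y. ennreal (f y) * ennreal (K (x - y)) \<partial>lborel \<partial>lborel) = T * (\<integral>\<^sup>+x. ennreal (f x) \<partial>lborel)" .
  have "(\<integral>\<^sup>+x. \<integral>\<^sup>+y. ennreal ((f x + f y) * K (x - y)) \<partial>lborel \<partial>lborel) =
    (\<integral>\<^sup>+x. \<integral>\<^sup>+y. ennreal (f x) * ennreal (K (x - y)) + ennreal (f y) * ennreal (K (x - y)) \<partial>lborel \<partial>lborel)"
    using f K0 by (simp add: distrib_right ennreal_mult)
  also have "\<dots> = T * (\<integral>\<^sup>+x. ennreal (f x) \<partial>lborel) + T * (\<integral>\<^sup>+x. ennreal (f x) \<partial>lborel)"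
    by (simp add: nn_integral_add 1 2)
  also have "\<dots> = ennreal (2 * tail_mass TYPE('a) r d) * (\<integral>\<^sup>+x. ennreal (f x) \<partial>lborel)"
    by (simp add: T_def ennreal_mult' mult.assoc flip: mult_2)
  finally show ?thesis unfolding K_def .
qed

text \<open>Keep only pairs at distance at least \<open>d\<close> and expand the square. The
  diagonal terms give the tail mass; in the cross term the kernel is at most
  \<open>d powr - (DIM('a) + 2 * r)\<close>, which leaves a product of L1 norms. Because the tail
  mass grows without bound as \<open>d\<close> shrinks, energy and L1 norm together control the L2
  norm with an arbitrarily large constant on the left.\<close>

lemma energy_coercive:
  fixes w :: "'a::euclidean_space \<Rightarrow> real"
  assumes "r > 0" "d > 0" and [measurable]: "w \<in> borel_measurable borel"
  shows "ennreal (2 * tail_mass TYPE('a) r d) * (\<integral>\<^sup>+x. ennreal ((w x)\<^sup>2) \<partial>lborel) \<le>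
    energy r w + ennreal (2 * d powr - (real DIM('a) + 2 * r)) * (\<integral>\<^sup>+x. ennreal \<bar>w x\<bar> \<partial>lborel)\<^sup>2"
proof -
  define D where "D = 2 * d powr - (real DIM('a) + 2 * r)"
  have "ennreal (2 * tail_mass TYPE('a) r d) * (\<integral>\<^sup>+x. ennreal ((w x)\<^sup>2) \<partial>lborel) =
    (\<integral>\<^sup>+x. \<integral>\<^sup>+y. ennreal (((w x)\<^sup>2 + (w y)\<^sup>2) * (frac_ker r (x - y) * indicator {z. d \<le> norm z} (x - y))) \<partial>lborel \<partial>lborel)"
    using assms by (intro nn_integral_tail_convolution[symmetric]) auto
  also have "\<dots> \<le> (\<integral>\<^sup>+x. \<integral>\<^sup>+y. ennreal ((w x - w y)\<^sup>2 * frac_ker r (x - y)) +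
       ennreal D * (ennreal \<bar>w x\<bar> * ennreal \<bar>w y\<bar>) \<partial>lborel \<partial>lborel)"
  proof (intro nn_integral_mono)
    fix x y :: 'a
    have "((w x)\<^sup>2 + (w y)\<^sup>2) * (frac_ker r (x - y) * indicator {z. d \<le> norm z} (x - y)) \<le>
       (w x - w y)\<^sup>2 * frac_ker r (x - y) + D * (\<bar>w x\<bar> * \<bar>w y\<bar>)"
    proof (cases "d \<le> norm (x - y)")
      case True
      have "frac_ker r (x - y) \<le> D / 2"
        unfolding frac_ker_def D_def using True assms by (simp, intro powr_mono2') auto
      then have "2 * frac_ker r (x - y) * (\<bar>w x\<bar> * \<bar>w y\<bar>) \<le> D * (\<bar>w x\<bar> * \<bar>w y\<bar>)"
        by (intro mult_right_mono) auto
      moreover have "(w x)\<^sup>2 + (w y)\<^sup>2 \<le> (w x - w y)\<^sup>2 + 2 * (\<bar>w x\<bar> * \<bar>w y\<bar>)"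
        using abs_ge_self[of "w x * w y"] by (simp add: power2_diff abs_mult)
      then have "((w x)\<^sup>2 + (w y)\<^sup>2) * frac_ker r (x - y) \<le> ((w x - w y)\<^sup>2 + 2 * (\<bar>w x\<bar> * \<bar>w y\<bar>)) * frac_ker r (x - y)"
        by (rule mult_right_mono) simp
      ultimately show ?thesis using True by (simp add: algebra_simps)
    qed (simp add: D_def)
    then show "ennreal (((w x)\<^sup>2 + (w y)\<^sup>2) * (frac_ker r (x - y) * indicator {z. d \<le> norm z} (x - y))) \<le>
       ennreal ((w x - w y)\<^sup>2 * frac_ker r (x - y)) + ennreal D * (ennreal \<bar>w x\<bar> * ennreal \<bar>w y\<bar>)"
      by (simp add: D_def ennreal_leI flip: ennreal_mult ennreal_plus)
  qed
  also have "\<dots> = energy r w + ennreal D * (\<integral>\<^sup>+x. ennreal \<bar>w x\<bar> \<partial>lborel)\<^sup>2"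
    by (simp add: energy_def nn_integral_add nn_integral_cmult nn_integral_multc power2_eq_square)
  finally show ?thesis unfolding D_def .
qed

text \<open>Two points at distance at least \<open>R\<close> cannot both lie in \<Omega>. For such a
  pair the cross term vanishes, and the square of the difference is the sum of the squares.\<close>

lemma energy_lower:
  fixes w :: "'a::euclidean_space \<Rightarrow> real"
  assumes "r > 0" "R > 0" and [measurable]: "w \<in> borel_measurable borel"
    and supp: "\<And>x. x \<notin> \<Omega> \<Longrightarrow> w x = 0" and diam: "\<And>x y. x \<in> \<Omega> \<Longrightarrow> y \<in> \<Omega> \<Longrightarrow> norm (x - y) < R"
  shows "ennreal (2 * tail_mass TYPE('a) r R) * (\<integral>\<^sup>+x. ennreal ((w x)\<^sup>2) \<partial>lborel) \<le> energy r w"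
proof -
  have "ennreal (2 * tail_mass TYPE('a) r R) * (\<integral>\<^sup>+x. ennreal ((w x)\<^sup>2) \<partial>lborel) =
    (\<integral>\<^sup>+x. \<integral>\<^sup>+y. ennreal (((w x)\<^sup>2 + (w y)\<^sup>2) * (frac_ker r (x - y) * indicator {z. R \<le> norm z} (x - y))) \<partial>lborel \<partial>lborel)"
    using assms(1,2) by (intro nn_integral_tail_convolution[symmetric]) auto
  also have "\<dots> \<le> energy r w"
    unfolding energy_def
  proof (intro nn_integral_mono ennreal_leI)
    fix x y :: 'a
    show "((w x)\<^sup>2 + (w y)\<^sup>2) * (frac_ker r (x - y) * indicator {z. R \<le> norm z} (x - y)) \<le> (w x - w y)\<^sup>2 * frac_ker r (x - y)"
    proof (cases "R \<le> norm (x - y)")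
      case True
      then have "w x = 0 \<or> w y = 0" using diam supp by (meson not_le)
      then show ?thesis using True by auto
    qed simp
  qed
  finally show ?thesis .
qed

text \<open>For pairs at distance at least 1, nonnegativity allows the cross term to be dropped,
  which leaves the tail convolution of \<open>v\<close> squared. For closer pairs the Lipschitz
  bound cancels the singularity, and such a pair contributes only if \<open>x\<close> is within
  \<open>\<rho> + 1\<close> of \<open>c\<close>.\<close>

lemma energy_upper:
  fixes v :: "'a::euclidean_space \<Rightarrow> real"
  assumes "0 < r" "r \<le> 1/2" and [measurable]: "v \<in> borel_measurable borel"
    and nonneg: "\<And>x. v x \<ge> 0" and lip: "\<And>x y. \<bar>v x - v y\<bar> \<le> norm (x - y)"
    and supp: "\<And>x. x \<notin> ball c \<rho> \<Longrightarrow> v x = 0"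
  shows "energy r v \<le> ennreal (near_mass TYPE('a) * measure lborel (cball c (\<rho> + 1))) +
     ennreal (2 * tail_mass TYPE('a) r 1) * (\<integral>\<^sup>+x. ennreal ((v x)\<^sup>2) \<partial>lborel)"
proof -
  define g where "g = (\<lambda>z::'a. norm z powr - (real DIM('a) - 1) * indicator (cball 0 1) z)"
  have [measurable]: "cball (a::'a) t \<in> sets borel" for a t by simp
  have [measurable]: "g \<in> borel_measurable borel" unfolding g_def by measurable
  have g: "(\<integral>\<^sup>+y. ennreal (g (x - y)) \<partial>lborel) = ennreal (near_mass TYPE('a))" for x
  proof -
    have "(\<integral>\<^sup>+y. ennreal (g (x - y)) \<partial>lborel) = (\<integral>\<^sup>+y. ennreal (g y) \<partial>lborel)"
      by (rule nn_integral_lborel_reflect) measurable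
    also have "\<dots> = ennreal (near_mass TYPE('a))"
      unfolding g_def near_mass_def by (intro nn_integral_eq_integral integrable_near) auto
    finally show ?thesis .
  qed
  have "energy r v \<le> (\<integral>\<^sup>+x. \<integral>\<^sup>+y. indicator (cball c (\<rho> + 1)) x * ennreal (g (x - y)) +
      ennreal (((v x)\<^sup>2 + (v y)\<^sup>2) * (frac_ker r (x - y) * indicator {z. 1 \<le> norm z} (x - y))) \<partial>lborel \<partial>lborel)"
    unfolding energy_def
  proof (intro nn_integral_mono)
    fix x y :: 'a
    have "(v x - v y)\<^sup>2 * frac_ker r (x - y) \<le> indicator (cball c (\<rho> + 1)) x * g (x - y) +
       ((v x)\<^sup>2 + (v y)\<^sup>2) * (frac_ker r (x - y) * indicator {z. 1 \<le> norm z} (x - y))"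
    proof (cases "1 \<le> norm (x - y)")
      case True
      have "(v x - v y)\<^sup>2 \<le> (v x)\<^sup>2 + (v y)\<^sup>2" using nonneg[of x] nonneg[of y] by (simp add: power2_diff)
      then have "(v x - v y)\<^sup>2 * frac_ker r (x - y) \<le> ((v x)\<^sup>2 + (v y)\<^sup>2) * frac_ker r (x - y)"
        by (rule mult_right_mono) simp
      moreover have "0 \<le> indicator (cball c (\<rho> + 1)) x * g (x - y)" by (simp add: g_def)
      ultimately show ?thesis using True by simp
    next
      case False
      show ?thesis
      proof (cases "x \<in> cball c (\<rho> + 1)")
        case True
        have "(v x - v y)\<^sup>2 \<le> (norm (x - y))\<^sup>2"
          using lip[of x y] by (simp flip: abs_le_square_iff)
        then have "(v x - v y)\<^sup>2 * frac_ker r (x - y) \<le> (norm (x - y))\<^sup>2 * frac_ker r (x - y)"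
          by (rule mult_right_mono) simp
        also have "\<dots> \<le> g (x - y)"
          unfolding g_def using False assms sq_frac_ker_le[of r "x - y"] by simp
        finally show ?thesis using True False by simp
      next
        case out: False
        then have "\<rho> + 1 < dist c x" by simp
        also have "dist c x \<le> dist c y + dist y x" by (rule dist_triangle)
        finally have "\<rho> < dist c y" using False by (simp add: dist_norm norm_minus_commute)
        then have "v x = 0" "v y = 0" using out by (auto intro!: supp)
        then show ?thesis by (simp add: g_def)
      qed
    qed
    then have "ennreal ((v x - v y)\<^sup>2 * frac_ker r (x - y)) \<le> ennreal (indicator (cball c (\<rho> + 1)) x * g (x - y) +
       ((v x)\<^sup>2 + (v y)\<^sup>2) * (frac_ker r (x - y) * indicator {z. 1 \<le> norm z} (x - y)))"
      by (rule ennreal_leI)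
    also have "\<dots> = indicator (cball c (\<rho> + 1)) x * ennreal (g (x - y)) +
      ennreal (((v x)\<^sup>2 + (v y)\<^sup>2) * (frac_ker r (x - y) * indicator {z. 1 \<le> norm z} (x - y)))"
      by (subst ennreal_plus) (auto simp: g_def indicator_def)
    finally show "ennreal ((v x - v y)\<^sup>2 * frac_ker r (x - y)) \<le> \<dots>" .
  qed
  also have "\<dots> = (\<integral>\<^sup>+x. \<integral>\<^sup>+y. indicator (cball c (\<rho> + 1)) x * ennreal (g (x - y)) \<partial>lborel \<partial>lborel) +
     ennreal (2 * tail_mass TYPE('a) r 1) * (\<integral>\<^sup>+x. ennreal ((v x)\<^sup>2) \<partial>lborel)"
    using assms(1) nn_integral_tail_convolution[of r 1 "\<lambda>x. (v x)\<^sup>2"]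
    by (simp add: nn_integral_add)
  also have "(\<integral>\<^sup>+x. \<integral>\<^sup>+y. indicator (cball c (\<rho> + 1)) x * ennreal (g (x - y)) \<partial>lborel \<partial>lborel) =
      ennreal (near_mass TYPE('a) * measure lborel (cball c (\<rho> + 1)))"
    using emeasure_lborel_cball_finite[of c "\<rho> + 1"] near_mass_nonneg[of "TYPE('a)"]
    by (simp add: nn_integral_cmult g nn_integral_multc ennreal_mult emeasure_eq_ennreal_measure mult.commute)
  finally show ?thesis .
qed

section \<open>Comparison, scaling and lower semicontinuity of the energy\<close>

lemma energy_mono:
  assumes "\<And>x y. (u x - u y)\<^sup>2 \<le> (v x - v y)\<^sup>2"
  shows "energy r u \<le> energy r v"
  unfolding energy_def using assms by (intro nn_integral_mono ennreal_leI mult_right_mono) auto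

lemma energy_cong_AE:
  assumes "AE x in lborel. u x = v x"
  shows "energy r u = energy r v"
  unfolding energy_def
proof (rule nn_integral_cong_AE, use assms in eventually_elim)
  case (elim x)
  show ?case by (rule nn_integral_cong_AE, use assms in eventually_elim) (simp add: elim)
qed

lemma energy_scale:
  assumes [measurable]: "v \<in> borel_measurable borel"
  shows "energy r (\<lambda>x. c * v x) = ennreal (c\<^sup>2) * energy r v"
proof -
  have "(c * v x - c * v y)\<^sup>2 * k = c\<^sup>2 * ((v x - v y)\<^sup>2 * k)" for x y k
    by (simp add: algebra_simps power2_eq_square)
  then have "energy r (\<lambda>x. c * v x) =
      (\<integral>\<^sup>+x. \<integral>\<^sup>+y. ennreal (c\<^sup>2) * ennreal ((v x - v y)\<^sup>2 * frac_ker r (x - y)) \<partial>lborel \<partial>lborel)"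
    unfolding energy_def by (simp only: ennreal_mult'[OF zero_le_power2])
  then show ?thesis by (simp add: energy_def nn_integral_cmult)
qed

lemma energy_diff_le:
  assumes [measurable]: "u \<in> borel_measurable borel" "v \<in> borel_measurable borel"
  shows "energy r (\<lambda>x. u x - v x) \<le> 2 * energy r u + 2 * energy r v"
proof -
  have "energy r (\<lambda>x. u x - v x) \<le> (\<integral>\<^sup>+x. \<integral>\<^sup>+y. 2 * ennreal ((u x - u y)\<^sup>2 * frac_ker r (x - y)) +
     2 * ennreal ((v x - v y)\<^sup>2 * frac_ker r (x - y)) \<partial>lborel \<partial>lborel)"
    unfolding energy_def
  proof (intro nn_integral_mono)
    fix x y
    have "(u x - v x - (u y - v y))\<^sup>2 \<le> 2 * (u x - u y)\<^sup>2 + 2 * (v x - v y)\<^sup>2"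
      using zero_le_power2[of "u x - u y + (v x - v y)"]
      by (simp add: power2_eq_square algebra_simps)
    then have "(u x - v x - (u y - v y))\<^sup>2 * frac_ker r (x - y) \<le>
        (2 * (u x - u y)\<^sup>2 + 2 * (v x - v y)\<^sup>2) * frac_ker r (x - y)"
      by (rule mult_right_mono) simp
    also have "\<dots> = 2 * ((u x - u y)\<^sup>2 * frac_ker r (x - y)) + 2 * ((v x - v y)\<^sup>2 * frac_ker r (x - y))"
      by (simp only: distrib_right mult.assoc)
    finally have "(u x - v x - (u y - v y))\<^sup>2 * frac_ker r (x - y) \<le> \<dots>" .
    from ennreal_leI[OF this] show "ennreal ((u x - v x - (u y - v y))\<^sup>2 * frac_ker r (x - y)) \<le>
      2 * ennreal ((u x - u y)\<^sup>2 * frac_ker r (x - y)) + 2 * ennreal ((v x - v y)\<^sup>2 * frac_ker r (x - y))"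
      by (simp add: ennreal_mult' ennreal_plus)
  qed
  also have "\<dots> = 2 * energy r u + 2 * energy r v"
    unfolding energy_def by (simp add: nn_integral_add nn_integral_cmult)
  finally show ?thesis .
qed

lemma energy_Fatou:
  assumes [measurable]: "\<And>n. u n \<in> borel_measurable borel" "v \<in> borel_measurable borel"
    and lim: "AE x in lborel. (\<lambda>n. u n x) \<longlonglongrightarrow> v x"
  shows "energy r v \<le> liminf (\<lambda>n. energy r (u n))"
proof -
  have "energy r v = (\<integral>\<^sup>+x. \<integral>\<^sup>+y. liminf (\<lambda>n. ennreal ((u n x - u n y)\<^sup>2 * frac_ker r (x - y))) \<partial>lborel \<partial>lborel)"
    unfolding energy_def
  proof (rule nn_integral_cong_AE, use lim in eventually_elim)
    case x: (elim x)
    show ?case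
    proof (rule nn_integral_cong_AE, use lim in eventually_elim)
      case y: (elim y)
      have "(\<lambda>n. ennreal ((u n x - u n y)\<^sup>2 * frac_ker r (x - y))) \<longlonglongrightarrow> ennreal ((v x - v y)\<^sup>2 * frac_ker r (x - y))"
        by (intro tendsto_intros x y)
      then show ?case by (intro lim_imp_Liminf[symmetric]) auto
    qed
  qed
  also have "\<dots> \<le> (\<integral>\<^sup>+x. liminf (\<lambda>n. \<integral>\<^sup>+y. ennreal ((u n x - u n y)\<^sup>2 * frac_ker r (x - y)) \<partial>lborel) \<partial>lborel)"
    by (intro nn_integral_mono nn_integral_liminf) measurable
  also have "\<dots> \<le> liminf (\<lambda>n. energy r (u n))"
    unfolding energy_def by (intro nn_integral_liminf) measurable
  finally show ?thesis .
qed

section \<open>Hidden convexity\<close>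

lemma tail_mass_pos: "0 < r \<Longrightarrow> r \<le> 1 \<Longrightarrow> tail_mass TYPE('a::euclidean_space) r 1 > 0"
proof -
  assume r: "0 < r" "r \<le> 1"
  obtain c where "c > 0" and c: "c / (1 - 2 powr (- 2 * r)) \<le> tail_mass TYPE('a) r 1"
    using tail_mass_lower[where 'a = 'a] r by blast
  moreover have "2 powr (- 2 * r) < 1" using r by (simp add: powr_less_one)
  ultimately show ?thesis by (smt (verit) divide_pos_pos)
qed

text \<open>By the scaling law the equation \<open>tail_mass r d = max M 1\<close> can be solved for
  \<open>d\<close>; the maximum keeps the base of the power positive for every \<open>M\<close>.
  This small \<open>d\<close> is what \<open>energy_coercive\<close> is fed with.\<close>

lemma tail_mass_unbounded:
  assumes "0 < r" "r \<le> 1"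
  shows "\<exists>d>0. M \<le> tail_mass TYPE('a::euclidean_space) r d"
proof -
  define J where "J = tail_mass TYPE('a) r 1"
  define q where "q = max M 1 / J"
  have "J > 0" unfolding J_def by (rule tail_mass_pos[OF assms])
  then have "q > 0" by (simp add: q_def)
  define d where "d = q powr (- 1 / (2 * r))"
  have "d > 0" using \<open>q > 0\<close> by (simp add: d_def)
  moreover have "d powr (- 2 * r) = q"
    using assms \<open>q > 0\<close> by (simp add: d_def powr_powr)
  then have "tail_mass TYPE('a) r d = max M 1"
    using tail_mass_scale[of r d, where 'a = 'a] assms \<open>d > 0\<close> \<open>J > 0\<close> by (simp add: q_def flip: J_def)
  ultimately show ?thesis by (intro exI[of _ d]) auto
qed

text \<open>The map \<open>\<rho> \<mapsto> energy r (sqrt \<rho>)\<close> is convex on nonnegative functions. Pointwise, with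
  \<open>s\<close> the root mean square of \<open>a\<close> and \<open>b\<close>, the defect is a Cauchy-Schwarz defect of the
  vectors \<open>(a\<^sub>1, b\<^sub>1)\<close> and \<open>(a\<^sub>2, b\<^sub>2)\<close>, which controls the determinant \<open>a\<^sub>1 b\<^sub>2 - a\<^sub>2 b\<^sub>1\<close>.\<close>

lemma rms_defect:
  fixes a\<^sub>1 a\<^sub>2 b\<^sub>1 b\<^sub>2 :: real
  defines "s\<^sub>1 \<equiv> sqrt ((a\<^sub>1\<^sup>2 + b\<^sub>1\<^sup>2) / 2)" and "s\<^sub>2 \<equiv> sqrt ((a\<^sub>2\<^sup>2 + b\<^sub>2\<^sup>2) / 2)"
  defines "D \<equiv> 2 * s\<^sub>1 * s\<^sub>2 - a\<^sub>1 * a\<^sub>2 - b\<^sub>1 * b\<^sub>2"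
  shows "0 \<le> D"
    and "(a\<^sub>1 - a\<^sub>2)\<^sup>2 + (b\<^sub>1 - b\<^sub>2)\<^sup>2 = 2 * (s\<^sub>1 - s\<^sub>2)\<^sup>2 + 2 * D"
    and "t > 0 \<Longrightarrow> \<bar>a\<^sub>1 * b\<^sub>2 - a\<^sub>2 * b\<^sub>1\<bar> \<le> 2 * t * (s\<^sub>1 * s\<^sub>2) + D / (2 * t)"
proof -
  have s: "s\<^sub>1 \<ge> 0" "s\<^sub>2 \<ge> 0" "s\<^sub>1\<^sup>2 = (a\<^sub>1\<^sup>2 + b\<^sub>1\<^sup>2) / 2" "s\<^sub>2\<^sup>2 = (a\<^sub>2\<^sup>2 + b\<^sub>2\<^sup>2) / 2"
    by (auto simp: s\<^sub>1_def s\<^sub>2_def)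
  define S where "S = a\<^sub>1 * a\<^sub>2 + b\<^sub>1 * b\<^sub>2"
  \<comment> \<open>Lagrange's identity for the vectors \<open>(a\<^sub>1, b\<^sub>1)\<close> and
    \<open>(a\<^sub>2, b\<^sub>2)\<close>, whose squared lengths are
    \<open>2 * s\<^sub>1\<^sup>2\<close> and \<open>2 * s\<^sub>2\<^sup>2\<close>.\<close>
  have det: "(a\<^sub>1 * b\<^sub>2 - a\<^sub>2 * b\<^sub>1)\<^sup>2 = (2 * s\<^sub>1 * s\<^sub>2)\<^sup>2 - S\<^sup>2"
    unfolding power_mult_distrib s S_def by (simp add: power2_eq_square field_simps)
  have "S\<^sup>2 \<le> (2 * s\<^sub>1 * s\<^sub>2)\<^sup>2"
    using det zero_le_power2[of "a\<^sub>1 * b\<^sub>2 - a\<^sub>2 * b\<^sub>1"] by linarith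
  then have S: "S \<le> 2 * s\<^sub>1 * s\<^sub>2" by (rule power2_le_imp_le) (simp add: s(1,2))
  then show D: "0 \<le> D" by (simp add: D_def S_def)
  show "(a\<^sub>1 - a\<^sub>2)\<^sup>2 + (b\<^sub>1 - b\<^sub>2)\<^sup>2 = 2 * (s\<^sub>1 - s\<^sub>2)\<^sup>2 + 2 * D"
    unfolding power2_diff s D_def by (simp add: algebra_simps add_divide_distrib)
  assume "t > 0"
  have "(a\<^sub>1 * b\<^sub>2 - a\<^sub>2 * b\<^sub>1)\<^sup>2 = D * (2 * s\<^sub>1 * s\<^sub>2 + S)"
    unfolding det D_def S_def by (simp add: power2_eq_square algebra_simps)
  also have "\<dots> \<le> D * (4 * s\<^sub>1 * s\<^sub>2)"
    using S D by (intro mult_left_mono) auto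
  \<comment> \<open>The bound \<open>4 * p * q \<le> (p + q)\<^sup>2\<close> with a free weight
    \<open>t\<close>: a small \<open>t\<close> makes the first summand small, after which a small
    defect controls the second.\<close>
  also have "\<dots> = 4 * (2 * t * (s\<^sub>1 * s\<^sub>2)) * (D / (2 * t))" using \<open>t > 0\<close> by simp
  also have "\<dots> \<le> (2 * t * (s\<^sub>1 * s\<^sub>2) + D / (2 * t))\<^sup>2"
    using zero_le_power2[of "2 * t * (s\<^sub>1 * s\<^sub>2) - D / (2 * t)"]
    unfolding power2_diff power2_sum by linarith
  finally have "(a\<^sub>1 * b\<^sub>2 - a\<^sub>2 * b\<^sub>1)\<^sup>2 \<le> (2 * t * (s\<^sub>1 * s\<^sub>2) + D / (2 * t))\<^sup>2" .
  moreover have "0 \<le> 2 * t * (s\<^sub>1 * s\<^sub>2)" "0 \<le> D / (2 * t)"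
    using s(1,2) D \<open>t > 0\<close> by simp_all
  ultimately show "\<bar>a\<^sub>1 * b\<^sub>2 - a\<^sub>2 * b\<^sub>1\<bar> \<le> 2 * t * (s\<^sub>1 * s\<^sub>2) + D / (2 * t)"
    using power2_le_iff_abs_le[OF add_nonneg_nonneg] by blast
qed

text \<open>Sign and support conditions hold at every point rather than almost everywhere, so
  pointwise estimates need no exceptional sets; \<open>X_space_to_nonneg_sphere\<close> brings a
  general competitor into this form. Finite energy is not demanded.\<close>

definition nonneg_sphere :: "'a::euclidean_space set \<Rightarrow> ('a \<Rightarrow> real) set" where
  "nonneg_sphere \<Omega> = {v \<in> borel_measurable borel. (\<forall>x. 0 \<le> v x) \<and> (\<forall>x. x \<notin> \<Omega> \<longrightarrow> v x = 0) \<and>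
     (\<integral>\<^sup>+x. ennreal ((v x)\<^sup>2) \<partial>lborel) = 1}"

lemma nonneg_sphereD:
  assumes "v \<in> nonneg_sphere \<Omega>"
  shows "v \<in> borel_measurable borel" "\<And>x. 0 \<le> v x" "\<And>x. x \<notin> \<Omega> \<Longrightarrow> v x = 0"
    "(\<integral>\<^sup>+x. ennreal ((v x)\<^sup>2) \<partial>lborel) = 1"
  using assms by (auto simp: nonneg_sphere_def)

text \<open>In terms of the density, the square of the function, the constraint is affine and the
  root mean square is a midpoint. This makes it a competitor in the minimization.\<close>

lemma nonneg_sphere_rms:
  assumes "a \<in> nonneg_sphere \<Omega>" "b \<in> nonneg_sphere \<Omega>"
  shows "(\<lambda>x. sqrt (((a x)\<^sup>2 + (b x)\<^sup>2) / 2)) \<in> nonneg_sphere \<Omega>"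
proof -
  note a = nonneg_sphereD[OF assms(1)] and b = nonneg_sphereD[OF assms(2)]
  note [measurable] = a(1) b(1)
  have "(\<integral>\<^sup>+x. ennreal ((sqrt (((a x)\<^sup>2 + (b x)\<^sup>2) / 2))\<^sup>2) \<partial>lborel) =
    (\<integral>\<^sup>+x. ennreal (1/2) * ennreal ((a x)\<^sup>2) + ennreal (1/2) * ennreal ((b x)\<^sup>2) \<partial>lborel)"
  proof (rule nn_integral_cong)
    fix x
    have "ennreal (p / 2 + q / 2) = ennreal (1/2) * ennreal p + ennreal (1/2) * ennreal q"
      if "p \<ge> 0" "q \<ge> 0" for p q
      using that by (subst (1 2) ennreal_mult[symmetric]) (simp_all add: ennreal_plus)
    then show "ennreal ((sqrt (((a x)\<^sup>2 + (b x)\<^sup>2) / 2))\<^sup>2) =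
      ennreal (1/2) * ennreal ((a x)\<^sup>2) + ennreal (1/2) * ennreal ((b x)\<^sup>2)"
      by (simp add: add_divide_distrib)
  qed
  also have "\<dots> = ennreal (1/2) + ennreal (1/2)"
    by (simp add: nn_integral_add nn_integral_cmult a b)
  also have "\<dots> = 1" by (subst ennreal_plus[symmetric]) simp_all
  finally show ?thesis using a b by (simp add: nonneg_sphere_def)
qed

text \<open>Pointwise \<open>v x \<le> 1 + (v x)\<^sup>2\<close> on \<Omega>, which gives a bound
  independent of \<open>v\<close>.\<close>

lemma nonneg_sphere_integral_bound:
  assumes "v \<in> nonneg_sphere \<Omega>" and [measurable]: "\<Omega> \<in> sets borel" and fin: "emeasure lborel \<Omega> < \<infinity>"
  shows "(\<integral>\<^sup>+x. ennreal (v x) \<partial>lborel) \<le> ennreal (measure lborel \<Omega> + 1)"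
proof -
  note v = nonneg_sphereD[OF assms(1)]
  note [measurable] = v(1)
  have "(\<integral>\<^sup>+x. ennreal (v x) \<partial>lborel) \<le> (\<integral>\<^sup>+x. indicator \<Omega> x + ennreal ((v x)\<^sup>2) \<partial>lborel)"
  proof (rule nn_integral_mono)
    fix x
    have "v x \<le> 1 + (v x)\<^sup>2"
      using zero_le_power2[of "v x - 1"] v(2)[of x] by (simp add: power2_diff)
    then have "v x \<le> indicator \<Omega> x + (v x)\<^sup>2" using v(3)[of x] by (cases "x \<in> \<Omega>") auto
    from ennreal_leI[OF this] show "ennreal (v x) \<le> indicator \<Omega> x + ennreal ((v x)\<^sup>2)"
      by (simp add: ennreal_plus ennreal_indicator)
  qed
  also have "\<dots> = emeasure lborel \<Omega> + 1" using v by (simp add: nn_integral_add)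
  also have "\<dots> = ennreal (measure lborel \<Omega> + 1)"
    using fin by (simp add: emeasure_eq_ennreal_measure ennreal_plus)
  finally show ?thesis .
qed

text \<open>The energies of \<open>a\<close> and \<open>b\<close> add up to twice the energy of
  their root mean square \<open>s\<close> plus twice the integrated defect \<open>X\<close>. As
  \<open>s\<close> is itself a competitor, its energy is at least \<open>m\<close>, so
  \<open>X\<close> is at most \<open>\<epsilon>\<close>. On \<Omega> the kernel is at least
  \<open>\<kappa>\<close>, hence \<open>X\<close> also controls the unweighted defect, and the
  weighted determinant bound of \<open>rms_defect\<close> can be integrated.\<close>

lemma near_minimizers_determinant:
  fixes a b :: "'a::euclidean_space \<Rightarrow> real"
  assumes "r > 0" and a: "a \<in> nonneg_sphere \<Omega>" and b: "b \<in> nonneg_sphere \<Omega>"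
    and \<Omega>: "\<Omega> \<in> sets borel" "emeasure lborel \<Omega> < \<infinity>"
    and "R > 0" and diam: "\<And>x y. x \<in> \<Omega> \<Longrightarrow> y \<in> \<Omega> \<Longrightarrow> norm (x - y) < R"
    and min: "\<And>v. v \<in> nonneg_sphere \<Omega> \<Longrightarrow> ennreal m \<le> energy r v" and "m \<ge> 0"
    and near: "energy r a \<le> ennreal (m + \<epsilon>)" "energy r b \<le> ennreal (m + \<epsilon>)" and "\<epsilon> > 0" "t > 0"
  defines "\<kappa> \<equiv> R powr - (real DIM('a) + 2 * r)" and "V \<equiv> measure lborel \<Omega> + 1"
  shows "(\<integral>\<^sup>+x. \<integral>\<^sup>+y. ennreal \<bar>a x * b y - a y * b x\<bar> \<partial>lborel \<partial>lborel) \<le>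
     ennreal (2 * t * V\<^sup>2 + \<epsilon> / (2 * t * \<kappa>))"
proof -
  define s where "s = (\<lambda>x. sqrt (((a x)\<^sup>2 + (b x)\<^sup>2) / 2))"
  define D where "D = (\<lambda>x y. 2 * s x * s y - a x * a y - b x * b y)"
  define X where "X = (\<integral>\<^sup>+x. \<integral>\<^sup>+y. ennreal (D x y * frac_ker r (x - y)) \<partial>lborel \<partial>lborel)"
  note a = nonneg_sphereD[OF a] and b = nonneg_sphereD[OF b]
  have s: "s \<in> nonneg_sphere \<Omega>" unfolding s_def using assms by (intro nonneg_sphere_rms)
  note [measurable] = a(1) b(1) nonneg_sphereD(1)[OF s]
  have s0: "s x \<ge> 0" for x by (simp add: s_def)
  have rms: "0 \<le> D x y"
      "(a x - a y)\<^sup>2 + (b x - b y)\<^sup>2 = 2 * (s x - s y)\<^sup>2 + 2 * D x y"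
      "\<bar>a x * b y - a y * b x\<bar> \<le> 2 * t * (s x * s y) + D x y / (2 * t)" for x y
    unfolding D_def s_def
    by (rule rms_defect(1), rule rms_defect(2), rule rms_defect(3)[OF \<open>t > 0\<close>])
  have "\<kappa> > 0" using \<open>R > 0\<close> by (simp add: \<kappa>_def)
  have "energy r a + energy r b = (\<integral>\<^sup>+x. \<integral>\<^sup>+y. ennreal ((a x - a y)\<^sup>2 * frac_ker r (x - y)) +
      ennreal ((b x - b y)\<^sup>2 * frac_ker r (x - y)) \<partial>lborel \<partial>lborel)"
    unfolding energy_def by (simp add: nn_integral_add)
  also have "\<dots> = (\<integral>\<^sup>+x. \<integral>\<^sup>+y. 2 * ennreal ((s x - s y)\<^sup>2 * frac_ker r (x - y)) +
      2 * ennreal (D x y * frac_ker r (x - y)) \<partial>lborel \<partial>lborel)"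
  proof (intro nn_integral_cong)
    fix x y
    have "(a x - a y)\<^sup>2 * frac_ker r (x - y) + (b x - b y)\<^sup>2 * frac_ker r (x - y) =
      ((a x - a y)\<^sup>2 + (b x - b y)\<^sup>2) * frac_ker r (x - y)" by (rule distrib_right[symmetric])
    also have "\<dots> = 2 * ((s x - s y)\<^sup>2 * frac_ker r (x - y)) + 2 * (D x y * frac_ker r (x - y))"
      unfolding rms(2) by (simp only: distrib_right mult.assoc)
    finally have "ennreal ((a x - a y)\<^sup>2 * frac_ker r (x - y) + (b x - b y)\<^sup>2 * frac_ker r (x - y)) =
      ennreal (2 * ((s x - s y)\<^sup>2 * frac_ker r (x - y)) + 2 * (D x y * frac_ker r (x - y)))" by simp
    then show "ennreal ((a x - a y)\<^sup>2 * frac_ker r (x - y)) + ennreal ((b x - b y)\<^sup>2 * frac_ker r (x - y)) =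
      2 * ennreal ((s x - s y)\<^sup>2 * frac_ker r (x - y)) + 2 * ennreal (D x y * frac_ker r (x - y))"
      using rms(1)[of x y] by (simp add: ennreal_plus ennreal_mult'[of 2])
  qed
  also have "\<dots> = 2 * energy r s + 2 * X"
    unfolding energy_def X_def D_def by (simp add: nn_integral_add nn_integral_cmult)
  finally have "2 * energy r s + 2 * X \<le> 2 * ennreal (m + \<epsilon>)"
    using add_mono[OF near] by (simp add: mult_2)
  moreover have "2 * ennreal m \<le> 2 * energy r s" by (intro mult_left_mono min s) simp
  ultimately have "2 * ennreal m + 2 * X \<le> 2 * ennreal (m + \<epsilon>)"
    by (meson add_right_mono order_trans)
  \<comment> \<open>Cancelling \<open>2 * ennreal m\<close> is legitimate because it is finite; the
    case split first excludes an infinite \<open>X\<close>.\<close>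
  then have X: "X \<le> ennreal \<epsilon>"
    using \<open>m \<ge> 0\<close> \<open>\<epsilon> > 0\<close>
    by (cases X) (auto simp: ennreal_mult_eq_top_iff ennreal_add_eq_top top_unique simp flip: ennreal_numeral ennreal_mult ennreal_plus)
  have "(\<integral>\<^sup>+x. \<integral>\<^sup>+y. ennreal \<bar>a x * b y - a y * b x\<bar> \<partial>lborel \<partial>lborel) \<le>
    (\<integral>\<^sup>+x. \<integral>\<^sup>+y. ennreal (2 * t) * (ennreal (s x) * ennreal (s y)) +
       ennreal (1 / (2 * t * \<kappa>)) * ennreal (D x y * frac_ker r (x - y)) \<partial>lborel \<partial>lborel)"
  proof (intro nn_integral_mono)
    fix x y
    have rhs: "0 \<le> 2 * t * (s x * s y)" "0 \<le> 1 / (2 * t * \<kappa>) * (D x y * frac_ker r (x - y))"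
      using \<open>t > 0\<close> \<open>\<kappa> > 0\<close> s0 rms(1) by auto
    have "\<bar>a x * b y - a y * b x\<bar> \<le> 2 * t * (s x * s y) + 1 / (2 * t * \<kappa>) * (D x y * frac_ker r (x - y))"
    \<comment> \<open>The lower bound \<open>\<kappa>\<close> fails on the diagonal, where
      \<open>frac_ker\<close> is \<open>0\<close>. There, as well as when a point lies outside
      \<Omega>, the determinant itself vanishes.\<close>
    proof (cases "x \<in> \<Omega> \<and> y \<in> \<Omega> \<and> x \<noteq> y")
      case True
      then have "\<kappa> \<le> frac_ker r (x - y)"
        unfolding \<kappa>_def frac_ker_def using diam[of x y] \<open>r > 0\<close> by (intro powr_mono2') auto
      then have "D x y * \<kappa> \<le> D x y * frac_ker r (x - y)"
        using rms(1) by (rule mult_left_mono)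
      then have "D x y / (2 * t) \<le> 1 / (2 * t * \<kappa>) * (D x y * frac_ker r (x - y))"
        using \<open>t > 0\<close> \<open>\<kappa> > 0\<close> by (simp add: field_simps)
      then show ?thesis using rms(3)[of x y] by linarith
    next
      case False
      then have "a x * b y - a y * b x = 0" using a(3) b(3) by auto
      then show ?thesis using rhs by simp
    qed
    from ennreal_leI[OF this] show "ennreal \<bar>a x * b y - a y * b x\<bar> \<le>
       ennreal (2 * t) * (ennreal (s x) * ennreal (s y)) +
       ennreal (1 / (2 * t * \<kappa>)) * ennreal (D x y * frac_ker r (x - y))"
      using rhs \<open>t > 0\<close> \<open>\<kappa> > 0\<close> s0
      by (subst (asm) ennreal_plus) (simp_all only: ennreal_mult'[OF s0] ennreal_mult'[of "2 * t"] ennreal_mult'[of "1 / (2 * t * \<kappa>)"]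
        mult_nonneg_nonneg zero_le_divide_1_iff less_imp_le zero_le_numeral)
  qed
  also have "\<dots> = ennreal (2 * t) * (\<integral>\<^sup>+x. ennreal (s x) \<partial>lborel)\<^sup>2 + ennreal (1 / (2 * t * \<kappa>)) * X"
    unfolding X_def D_def
    by (simp add: nn_integral_add nn_integral_cmult nn_integral_multc power2_eq_square)
  also have "\<dots> \<le> ennreal (2 * t) * (ennreal V)\<^sup>2 + ennreal (1 / (2 * t * \<kappa>)) * ennreal \<epsilon>"
    unfolding V_def using \<Omega> s
    by (intro add_mono mult_left_mono power_mono nonneg_sphere_integral_bound X) auto
  also have "\<dots> = ennreal (2 * t * V\<^sup>2 + \<epsilon> / (2 * t * \<kappa>))"
    using \<open>t > 0\<close> \<open>\<epsilon> > 0\<close> \<open>\<kappa> > 0\<close>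
    by (simp add: V_def ennreal_power flip: ennreal_mult ennreal_plus)
  finally show ?thesis .
qed

section \<open>Near-minimizers form an \<open>L\<^sup>1\<close>-Cauchy family\<close>

lemma nonneg_sphere_integrable:
  assumes "v \<in> nonneg_sphere \<Omega>" "\<Omega> \<in> sets borel" "emeasure lborel \<Omega> < \<infinity>"
  shows "integrable lborel v" "(\<integral>\<^sup>+x. ennreal (v x) \<partial>lborel) = ennreal (integral\<^sup>L lborel v)"
proof -
  note v = nonneg_sphereD[OF assms(1)]
  show *: "integrable lborel v"
    using nonneg_sphere_integral_bound[OF assms] v
    by (intro integrableI_nonneg) (auto intro: le_less_trans)
  show "(\<integral>\<^sup>+x. ennreal (v x) \<partial>lborel) = ennreal (integral\<^sup>L lborel v)"
    using v by (intro nn_integral_eq_integral *) auto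
qed

text \<open>Bounded energy prevents concentration: if the L1 norm were tiny,
  \<open>energy_coercive\<close> at a small enough \<open>d\<close> would contradict the unit L2
  norm. The constant makes division by the integral safe for near-minimizers.\<close>

lemma nonneg_sphere_integral_lower:
  fixes \<Omega> :: "'a::euclidean_space set"
  assumes r: "0 < r" "r \<le> 1" and \<Omega>: "\<Omega> \<in> sets borel" "emeasure lborel \<Omega> < \<infinity>"
  shows "\<exists>c>0. \<forall>v\<in>nonneg_sphere \<Omega>. energy r v \<le> ennreal M \<longrightarrow> c \<le> integral\<^sup>L lborel v"
proof -
  obtain d where d: "d > 0" "\<bar>M\<bar> / 2 + 1 \<le> tail_mass TYPE('a) r d"
    using tail_mass_unbounded[OF r] by blast
  define D where "D = d powr - (real DIM('a) + 2 * r)"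
  have "D > 0" using d by (simp add: D_def)
  have "1 / sqrt D \<le> integral\<^sup>L lborel v" if v: "v \<in> nonneg_sphere \<Omega>" and E: "energy r v \<le> ennreal M" for v
  proof -
    note vD = nonneg_sphereD[OF v]
    define A where "A = integral\<^sup>L lborel v"
    have A: "A \<ge> 0" unfolding A_def using vD by (intro Bochner_Integration.integral_nonneg) auto
    have "(\<integral>\<^sup>+x. ennreal \<bar>v x\<bar> \<partial>lborel) = ennreal A"
      using nonneg_sphere_integrable(2)[OF v \<Omega>] vD by (simp add: A_def)
    then have "ennreal (2 * tail_mass TYPE('a) r d) \<le> energy r v + ennreal (2 * D) * (ennreal A)\<^sup>2"
      using energy_coercive[OF r(1) d(1) vD(1)] vD(4) by (simp add: D_def)
    also have "\<dots> \<le> ennreal \<bar>M\<bar> + ennreal (2 * D) * (ennreal A)\<^sup>2"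
      using E by (intro add_mono order_trans[OF E] ennreal_leI) auto
    also have "\<dots> = ennreal (\<bar>M\<bar> + 2 * D * A\<^sup>2)"
      using \<open>D > 0\<close> A by (simp add: ennreal_power flip: ennreal_mult ennreal_plus)
    finally have "2 * tail_mass TYPE('a) r d \<le> \<bar>M\<bar> + 2 * D * A\<^sup>2"
      using \<open>D > 0\<close> by (subst (asm) ennreal_le_iff) auto
    then have "1 \<le> D * A\<^sup>2" using d by linarith
    then have "(1 / sqrt D)\<^sup>2 \<le> A\<^sup>2" using \<open>D > 0\<close> by (simp add: power_divide field_simps)
    then show ?thesis using A unfolding A_def by (rule power2_le_imp_le)
  qed
  then show ?thesis using \<open>D > 0\<close> by (intro exI[of _ "1 / sqrt D"]) auto
qed

text \<open>Integrating \<open>a x * b y - a y * b x\<close> over \<open>y\<close> gives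
  \<open>a x * B - A * b x\<close> with \<open>A\<close> and \<open>B\<close> the two integrals.
  Division by \<open>A * B\<close>, which is at least the square of \<open>c\<close>, turns this
  into the difference of the normalised functions, so the determinant estimate becomes an L1
  estimate.\<close>

lemma near_minimizers_L1:
  fixes a b :: "'a::euclidean_space \<Rightarrow> real"
  assumes "r > 0" and a: "a \<in> nonneg_sphere \<Omega>" and b: "b \<in> nonneg_sphere \<Omega>"
    and \<Omega>: "\<Omega> \<in> sets borel" "emeasure lborel \<Omega> < \<infinity>"
    and "R > 0" and diam: "\<And>x y. x \<in> \<Omega> \<Longrightarrow> y \<in> \<Omega> \<Longrightarrow> norm (x - y) < R"
    and min: "\<And>v. v \<in> nonneg_sphere \<Omega> \<Longrightarrow> ennreal m \<le> energy r v" and "m \<ge> 0"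
    and near: "energy r a \<le> ennreal (m + \<epsilon>)" "energy r b \<le> ennreal (m + \<epsilon>)" and "\<epsilon> > 0" "t > 0"
    and c: "c > 0" "c \<le> integral\<^sup>L lborel a" "c \<le> integral\<^sup>L lborel b"
  defines "\<kappa> \<equiv> R powr - (real DIM('a) + 2 * r)" and "V \<equiv> measure lborel \<Omega> + 1"
  shows "(\<integral>\<^sup>+x. ennreal \<bar>a x / integral\<^sup>L lborel a - b x / integral\<^sup>L lborel b\<bar> \<partial>lborel) \<le>
     ennreal ((2 * t * V\<^sup>2 + \<epsilon> / (2 * t * \<kappa>)) / c\<^sup>2)"
proof -
  define A where "A = integral\<^sup>L lborel a"
  define B where "B = integral\<^sup>L lborel b"
  note [measurable] = nonneg_sphereD(1)[OF a] nonneg_sphereD(1)[OF b]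
  have AB: "A > 0" "B > 0" using c by (auto simp: A_def B_def)
  have ia: "integrable lborel a" and ib: "integrable lborel b"
    using nonneg_sphere_integrable(1) a b \<Omega> by auto
  have "c * c \<le> A * B" using c by (intro mult_mono) (auto simp: A_def B_def)
  have "(\<integral>\<^sup>+x. ennreal \<bar>a x / A - b x / B\<bar> \<partial>lborel) \<le>
    (\<integral>\<^sup>+x. ennreal (1 / c\<^sup>2) * (\<integral>\<^sup>+y. ennreal \<bar>a x * b y - a y * b x\<bar> \<partial>lborel) \<partial>lborel)"
  proof (rule nn_integral_mono)
    fix x
    have int: "integrable lborel (\<lambda>y. a x * b y - a y * b x)" using ia ib by simp
    have "\<bar>a x / A - b x / B\<bar> = \<bar>a x * B - A * b x\<bar> / (A * B)"
      using AB by (simp add: field_simps flip: abs_mult_pos)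
    also have "\<dots> \<le> \<bar>a x * B - A * b x\<bar> / c\<^sup>2"
      using \<open>c * c \<le> A * B\<close> c(1) by (intro divide_left_mono) (auto simp: power2_eq_square AB)
    also have "a x * B - A * b x = (\<integral>y. a x * b y - a y * b x \<partial>lborel)"
      using ia ib by (simp add: A_def B_def)
    finally have "ennreal \<bar>a x / A - b x / B\<bar> \<le>
        ennreal (1 / c\<^sup>2 * \<bar>\<integral>y. a x * b y - a y * b x \<partial>lborel\<bar>)"
      by (intro ennreal_leI) simp
    also have "\<dots> = ennreal (1 / c\<^sup>2) * ennreal (norm (\<integral>y. a x * b y - a y * b x \<partial>lborel))"
      by (subst ennreal_mult'[symmetric]) auto
    also have "\<dots> \<le> ennreal (1 / c\<^sup>2) * (\<integral>\<^sup>+y. ennreal (norm (a x * b y - a y * b x)) \<partial>lborel)"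
      by (intro mult_left_mono integral_norm_bound_ennreal int) simp
    finally show "ennreal \<bar>a x / A - b x / B\<bar> \<le>
        ennreal (1 / c\<^sup>2) * (\<integral>\<^sup>+y. ennreal \<bar>a x * b y - a y * b x\<bar> \<partial>lborel)" by simp
  qed
  also have "\<dots> = ennreal (1 / c\<^sup>2) * (\<integral>\<^sup>+x. \<integral>\<^sup>+y. ennreal \<bar>a x * b y - a y * b x\<bar> \<partial>lborel \<partial>lborel)"
    by (rule nn_integral_cmult) measurable
  also have "\<dots> \<le> ennreal (1 / c\<^sup>2) * ennreal (2 * t * V\<^sup>2 + \<epsilon> / (2 * t * \<kappa>))"
    unfolding V_def \<kappa>_def using assms
    by (intro mult_left_mono near_minimizers_determinant[where m = m and R = R]) auto
  also have "\<dots> = ennreal ((2 * t * V\<^sup>2 + \<epsilon> / (2 * t * \<kappa>)) / c\<^sup>2)"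
    by (subst ennreal_mult'[symmetric]) auto
  finally show ?thesis by (simp add: A_def B_def)
qed

text \<open>The increments have summable L1 norms, which gives convergence almost everywhere;
  Fatou's lemma then gives the rate. The limit is the explicit pointwise \<open>lim\<close>, so a
  point where all \<open>u n\<close> vanish is a zero of the limit, with no exceptional set.\<close>

lemma L1_geometric_Cauchy_limit:
  fixes u :: "nat \<Rightarrow> 'a \<Rightarrow> real"
  assumes [measurable]: "\<And>n. u n \<in> borel_measurable M"
    and cauchy: "\<And>n k. n \<le> k \<Longrightarrow> (\<integral>\<^sup>+x. ennreal \<bar>u n x - u k x\<bar> \<partial>M) \<le> ennreal ((1/2) ^ n)"
  defines "v \<equiv> \<lambda>x. lim (\<lambda>n. u n x)"
  shows "v \<in> borel_measurable M" "AE x in M. (\<lambda>n. u n x) \<longlonglongrightarrow> v x"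
    "(\<integral>\<^sup>+x. ennreal \<bar>u n x - v x\<bar> \<partial>M) \<le> ennreal ((1/2) ^ n)"
proof -
  show [measurable]: "v \<in> borel_measurable M" unfolding v_def by measurable
  have "(\<integral>\<^sup>+x. (\<Sum>n. ennreal \<bar>u n x - u (Suc n) x\<bar>) \<partial>M) = (\<Sum>n. \<integral>\<^sup>+x. ennreal \<bar>u n x - u (Suc n) x\<bar> \<partial>M)"
    by (rule nn_integral_suminf) measurable
  also have "\<dots> \<le> (\<Sum>n. ennreal ((1/2) ^ n))"
    by (intro suminf_le cauchy) auto
  also have "\<dots> = ennreal (\<Sum>n. (1/2) ^ n)"
    by (intro suminf_ennreal2 summable_geometric) auto
  also have "\<dots> < \<infinity>" by simp
  finally have "AE x in M. (\<Sum>n. ennreal \<bar>u n x - u (Suc n) x\<bar>) \<noteq> \<infinity>"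
    by (intro nn_integral_PInf_AE) auto
  then show ae: "AE x in M. (\<lambda>n. u n x) \<longlonglongrightarrow> v x"
  proof eventually_elim
    case (elim x)
    then have "summable (\<lambda>n. \<bar>u n x - u (Suc n) x\<bar>)"
      by (intro summable_suminf_not_top) auto
    then have "summable (\<lambda>n. u n x - u (Suc n) x)"
      by (rule summable_rabs_cancel)
    then have "summable (\<lambda>n. u (Suc n) x - u n x)"
      using summable_minus by fastforce
    then have "convergent (\<lambda>n. \<Sum>i<n. u (Suc i) x - u i x)"
      by (simp add: summable_iff_convergent)
    then have "convergent (\<lambda>n. u n x - u 0 x)"
      by (simp only: sum_lessThan_telescope[of "\<lambda>i. u i x"])
    then have "convergent (\<lambda>n. u n x)"
      using convergent_add[OF _ convergent_const[of "u 0 x"]] by fastforce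
    then show ?case by (simp add: v_def convergent_LIMSEQ_iff)
  qed
  have "(\<integral>\<^sup>+x. ennreal \<bar>u n x - v x\<bar> \<partial>M) = (\<integral>\<^sup>+x. liminf (\<lambda>k. ennreal \<bar>u n x - u k x\<bar>) \<partial>M)"
  proof (rule nn_integral_cong_AE, use ae in eventually_elim)
    case (elim x)
    have "(\<lambda>k. ennreal \<bar>u n x - u k x\<bar>) \<longlonglongrightarrow> ennreal \<bar>u n x - v x\<bar>"
      by (intro tendsto_intros elim)
    then show ?case by (intro lim_imp_Liminf[symmetric]) auto
  qed
  also have "\<dots> \<le> liminf (\<lambda>k. \<integral>\<^sup>+x. ennreal \<bar>u n x - u k x\<bar> \<partial>M)"
    by (rule nn_integral_liminf) measurable
  also have "\<dots> \<le> ennreal ((1/2) ^ n)"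
    by (intro Liminf_le eventually_mono[OF eventually_ge_at_top[of n]] cauchy) auto
  finally show "(\<integral>\<^sup>+x. ennreal \<bar>u n x - v x\<bar> \<partial>M) \<le> ennreal ((1/2) ^ n)" .
qed

section \<open>Existence of a minimizer\<close>

text \<open>The minimizer is compared only with nonnegative competitors and is not itself claimed to
  be nonnegative: it comes from a pointwise \<open>lim\<close>, whose value is unspecified where the
  sequence diverges.\<close>

lemma energy_minimizer_exists:
  fixes \<Omega> :: "'a::euclidean_space set"
  assumes r: "0 < r" "r \<le> 1" and \<Omega>: "\<Omega> \<in> sets borel" "emeasure lborel \<Omega> < \<infinity>"
    and "R > 0" and diam: "\<And>x y. x \<in> \<Omega> \<Longrightarrow> y \<in> \<Omega> \<Longrightarrow> norm (x - y) < R"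
    and fin: "\<exists>v\<in>nonneg_sphere \<Omega>. energy r v < \<infinity>"
  shows "\<exists>v \<in> borel_measurable borel. (\<forall>x. x \<notin> \<Omega> \<longrightarrow> v x = 0) \<and>
    (\<integral>\<^sup>+x. ennreal ((v x)\<^sup>2) \<partial>lborel) = 1 \<and> (\<forall>w\<in>nonneg_sphere \<Omega>. energy r v \<le> energy r w)"
proof -
  define m where "m = enn2real (INF v\<in>nonneg_sphere \<Omega>. energy r v)"
  have m0: "m \<ge> 0" by (simp add: m_def)
  have "(INF v\<in>nonneg_sphere \<Omega>. energy r v) < top"
    using fin by (auto simp: INF_less_iff)
  then have m: "(INF v\<in>nonneg_sphere \<Omega>. energy r v) = ennreal m"
    by (simp add: m_def)
  have min: "ennreal m \<le> energy r v" if "v \<in> nonneg_sphere \<Omega>" for v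
    unfolding m[symmetric] using that by (rule INF_lower)
  obtain c where c: "c > 0" "\<And>v. v \<in> nonneg_sphere \<Omega> \<Longrightarrow> energy r v \<le> ennreal (m + 1) \<Longrightarrow> c \<le> integral\<^sup>L lborel v"
    using nonneg_sphere_integral_lower[OF r \<Omega>, of "m + 1"] by blast
  define \<kappa> where "\<kappa> = R powr - (real DIM('a) + 2 * r)"
  define V where "V = measure lborel \<Omega> + 1"
  have "\<kappa> > 0" "V > 0" using \<open>R > 0\<close> by (auto simp: \<kappa>_def V_def add_nonneg_pos)
  have "\<exists>\<epsilon>. 0 < \<epsilon> \<and> \<epsilon> \<le> 1 \<and> (\<forall>a\<in>nonneg_sphere \<Omega>. \<forall>b\<in>nonneg_sphere \<Omega>.
      energy r a \<le> ennreal (m + \<epsilon>) \<longrightarrow> energy r b \<le> ennreal (m + \<epsilon>) \<longrightarrow>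
      (\<integral>\<^sup>+x. ennreal \<bar>a x / integral\<^sup>L lborel a - b x / integral\<^sup>L lborel b\<bar> \<partial>lborel) \<le> ennreal \<delta>)"
    if "\<delta> > 0" for \<delta>
  proof -
    \<comment> \<open>With this \<open>t\<close> the first term of the bound in
      \<open>near_minimizers_L1\<close> is exactly \<open>\<delta> / 2\<close>, and then
      \<open>\<epsilon>\<close> makes the second at most \<open>\<delta> / 2\<close>. The minimum
      with 1 keeps energies below \<open>m + 1\<close>, where the lower bound \<open>c\<close> on
      integrals is available.\<close>
    define t where "t = \<delta> * c\<^sup>2 / (4 * V\<^sup>2)"
    define \<epsilon> where "\<epsilon> = min 1 (t * \<kappa> * c\<^sup>2 * \<delta>)"
    have t: "t > 0" using \<open>V > 0\<close> that c by (simp add: t_def)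
    have \<epsilon>: "0 < \<epsilon>" "\<epsilon> \<le> 1" "\<epsilon> \<le> t * \<kappa> * c\<^sup>2 * \<delta>"
      using t that c \<open>\<kappa> > 0\<close> by (auto simp: \<epsilon>_def)
    have "2 * t * V\<^sup>2 = \<delta> * c\<^sup>2 / 2" using \<open>V > 0\<close> by (simp add: t_def)
    moreover have "\<epsilon> / (2 * t * \<kappa>) \<le> \<delta> * c\<^sup>2 / 2"
      using \<epsilon>(3) t \<open>\<kappa> > 0\<close> by (simp add: field_simps)
    ultimately have "2 * t * V\<^sup>2 + \<epsilon> / (2 * t * \<kappa>) \<le> \<delta> * c\<^sup>2" by linarith
    then have \<delta>: "(2 * t * V\<^sup>2 + \<epsilon> / (2 * t * \<kappa>)) / c\<^sup>2 \<le> \<delta>" using c by (simp add: pos_divide_le_eq)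
    have "(\<integral>\<^sup>+x. ennreal \<bar>a x / integral\<^sup>L lborel a - b x / integral\<^sup>L lborel b\<bar> \<partial>lborel) \<le> ennreal \<delta>"
      if ab: "a \<in> nonneg_sphere \<Omega>" "b \<in> nonneg_sphere \<Omega>"
        "energy r a \<le> ennreal (m + \<epsilon>)" "energy r b \<le> ennreal (m + \<epsilon>)" for a b
    proof -
      have "ennreal (m + \<epsilon>) \<le> ennreal (m + 1)" using \<epsilon> by (intro ennreal_leI) simp
      then have "c \<le> integral\<^sup>L lborel a" "c \<le> integral\<^sup>L lborel b"
        using c(2) ab by (auto intro: order_trans)
      from near_minimizers_L1[OF r(1) ab(1,2) \<Omega> \<open>R > 0\<close> diam min m0 ab(3,4) \<epsilon>(1) t c(1) this]
      show ?thesis using ennreal_leI[OF \<delta>] by (simp add: V_def \<kappa>_def)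
    qed
    then show ?thesis using \<epsilon> by blast
  qed
  note modulus = this
  define good where "good = (\<lambda>(n::nat) \<epsilon>. 0 < \<epsilon> \<and> \<epsilon> \<le> 1 \<and> (\<forall>a\<in>nonneg_sphere \<Omega>. \<forall>b\<in>nonneg_sphere \<Omega>.
      energy r a \<le> ennreal (m + \<epsilon>) \<longrightarrow> energy r b \<le> ennreal (m + \<epsilon>) \<longrightarrow>
      (\<integral>\<^sup>+x. ennreal \<bar>a x / integral\<^sup>L lborel a - b x / integral\<^sup>L lborel b\<bar> \<partial>lborel) \<le> ennreal ((1/2) ^ n)))"
  have "\<forall>n. \<exists>\<epsilon>. good n \<epsilon>"
    unfolding good_def by (intro allI modulus) simp
  then obtain e where "\<And>n. good n (e n)" by metis
  then have e: "0 < e n" "e n \<le> 1"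
    and eD: "\<And>a b. a \<in> nonneg_sphere \<Omega> \<Longrightarrow> b \<in> nonneg_sphere \<Omega> \<Longrightarrow>
      energy r a \<le> ennreal (m + e n) \<Longrightarrow> energy r b \<le> ennreal (m + e n) \<Longrightarrow>
      (\<integral>\<^sup>+x. ennreal \<bar>a x / integral\<^sup>L lborel a - b x / integral\<^sup>L lborel b\<bar> \<partial>lborel) \<le> ennreal ((1/2) ^ n)" for n
    unfolding good_def by blast+
  \<comment> \<open>Taking the minimum over all earlier thresholds gives
    \<open>f k \<le> e n\<close> for every \<open>k\<close> from \<open>n\<close> on, so all later
    members are close to the \<open>n\<close>-th; the second entry forces the energies down to
    \<open>m\<close>.\<close>
  define f where "f = (\<lambda>n. min (Min (e ` {..n})) (1 / (real n + 1)))"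
  have f0: "f n > 0" for n using e(1) by (auto simp: f_def)
  have f_le: "f k \<le> e n" if "n \<le> k" for n k
  proof -
    have "Min (e ` {..k}) \<le> e n" using that by (intro Min_le) auto
    then show ?thesis by (simp add: f_def)
  qed
  have f_inv: "f n \<le> 1 / (real n + 1)" for n by (simp add: f_def)
  have "\<forall>n. \<exists>v\<in>nonneg_sphere \<Omega>. energy r v < ennreal (m + f n)"
  proof
    fix n
    have "(INF v\<in>nonneg_sphere \<Omega>. energy r v) < ennreal (m + f n)"
      unfolding m using f0[of n] m0 by (intro ennreal_lessI) auto
    then show "\<exists>v\<in>nonneg_sphere \<Omega>. energy r v < ennreal (m + f n)" by (simp add: INF_less_iff)
  qed
  then obtain v where v: "\<And>n::nat. v n \<in> nonneg_sphere \<Omega>" and vE: "\<And>n. energy r (v n) < ennreal (m + f n)"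
    by metis
  note vD = nonneg_sphereD[OF v]
  note [measurable] = vD(1)
  define A where "A = (\<lambda>n. integral\<^sup>L lborel (v n))"
  have A: "c \<le> A n" "A n > 0" for n
  proof -
    have "energy r (v n) \<le> ennreal (m + 1)"
      using vE[of n] f_le[of n n] e(2)[of n]
      by (intro order_trans[OF less_imp_le[OF vE[of n]]] ennreal_leI) linarith
    then show "c \<le> A n" unfolding A_def by (intro c(2) v)
    then show "A n > 0" using c(1) by linarith
  qed
  define u where "u = (\<lambda>n x. v n x / A n)"
  have [measurable]: "u n \<in> borel_measurable borel" for n unfolding u_def by measurable
  have cauchy: "(\<integral>\<^sup>+x. ennreal \<bar>u n x - u k x\<bar> \<partial>lborel) \<le> ennreal ((1/2) ^ n)" if "n \<le> k" for n k
    unfolding u_def A_def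
  proof (rule eD[OF v v])
    show "energy r (v n) \<le> ennreal (m + e n)" "energy r (v k) \<le> ennreal (m + e n)"
      using f_le[of n n] f_le[OF that]
      by (auto intro!: order_trans[OF less_imp_le[OF vE]] ennreal_leI)
  qed
  define w where "w = (\<lambda>x. lim (\<lambda>n. u n x))"
  have "w \<in> borel_measurable lborel" and w_AE: "AE x in lborel. (\<lambda>n. u n x) \<longlonglongrightarrow> w x"
    and w_L1: "(\<integral>\<^sup>+x. ennreal \<bar>u n x - w x\<bar> \<partial>lborel) \<le> ennreal ((1/2) ^ n)" for n
    using L1_geometric_Cauchy_limit[of u lborel] cauchy by (simp_all add: w_def)
  then have [measurable]: "w \<in> borel_measurable borel" by simp
  have w_supp: "w x = 0" if "x \<notin> \<Omega>" for x
    using vD(3)[OF that] by (simp add: w_def u_def limI)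
  \<comment> \<open>The squared L2 norm of \<open>u n\<close>, because \<open>v n\<close> has norm
    1.\<close>
  define g where "g = (\<lambda>n. 1 / (A n)\<^sup>2)"
  have g: "0 \<le> g n" "g n \<le> 1 / c\<^sup>2" for n
    using A[of n] c(1) by (auto simp: g_def intro!: divide_left_mono power_mono)
  have u_sq: "(\<integral>\<^sup>+x. ennreal ((u n x)\<^sup>2) \<partial>lborel) = ennreal (g n)" for n
  proof -
    have "(\<integral>\<^sup>+x. ennreal ((u n x)\<^sup>2) \<partial>lborel) = (\<integral>\<^sup>+x. ennreal (g n) * ennreal ((v n x)\<^sup>2) \<partial>lborel)"
      using g(1) by (intro nn_integral_cong) (simp add: u_def g_def power_divide flip: ennreal_mult)
    also have "\<dots> = ennreal (g n)" using vD(4) by (simp add: nn_integral_cmult)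
    finally show ?thesis .
  qed
  have u_energy: "energy r (u n) \<le> ennreal (g n * (m + 1 / (real n + 1)))" for n
  proof -
    have "energy r (u n) = ennreal (g n) * energy r (v n)"
      using energy_scale[of "v n" r "1 / A n"] by (simp add: u_def[abs_def] g_def power_divide)
    also have "\<dots> \<le> ennreal (g n) * ennreal (m + 1 / (real n + 1))"
      using f_inv[of n] by (intro mult_left_mono order_trans[OF less_imp_le[OF vE]] ennreal_leI) auto
    also have "\<dots> = ennreal (g n * (m + 1 / (real n + 1)))"
      using g(1) by (simp add: ennreal_mult')
    finally show ?thesis .
  qed
  define Q where "Q = (m + 1) / c\<^sup>2"
  have "Q \<ge> 0" using m0 by (simp add: Q_def)
  have u_Q: "energy r (u n) \<le> ennreal Q" for n
  proof -
    have "g n * (m + 1 / (real n + 1)) \<le> 1 / c\<^sup>2 * (m + 1)"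
      using g[of n] m0 by (intro mult_mono add_left_mono) (auto simp: divide_simps)
    then show ?thesis by (intro order_trans[OF u_energy] ennreal_leI) (simp add: Q_def)
  qed
  have Fatou: "energy r w \<le> liminf (\<lambda>n. energy r (u n))"
    by (rule energy_Fatou) (use w_AE in auto)
  also have "\<dots> \<le> ennreal Q" using u_Q by (intro Liminf_le) auto
  finally have w_Q: "energy r w \<le> ennreal Q" .
  define d where "d = (\<lambda>n. \<integral>\<^sup>+x. ennreal ((u n x - w x)\<^sup>2) \<partial>lborel)"
  have d: "\<forall>\<^sub>F n in sequentially. d n \<le> ennreal \<eta>" if "\<eta> > 0" for \<eta>
  proof -
    \<comment> \<open>The energy of \<open>u n - w\<close> is at most \<open>4 * Q\<close>, and the
      extra 1 absorbs the L1 term, which is eventually below 1 for this fixed cutoff.\<close>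
    obtain \<delta> where \<delta>: "\<delta> > 0" "(4 * Q + 1) / (2 * \<eta>) \<le> tail_mass TYPE('a) r \<delta>"
      using tail_mass_unbounded[OF r] by blast
    define T where "T = tail_mass TYPE('a) r \<delta>"
    have "0 < (4 * Q + 1) / (2 * \<eta>)" using \<open>Q \<ge> 0\<close> that by simp
    then have T: "T > 0" "4 * Q + 1 \<le> 2 * T * \<eta>"
      using less_le_trans[OF _ \<delta>(2)] \<delta>(2) that by (simp_all add: T_def pos_divide_le_eq mult_ac)
    define D where "D = 2 * \<delta> powr - (real DIM('a) + 2 * r)"
    have "D \<ge> 0" by (simp add: D_def)
    have "(\<lambda>n. D * ((1/2) ^ n)\<^sup>2) \<longlonglongrightarrow> D * 0\<^sup>2"
      by (intro tendsto_intros LIMSEQ_realpow_zero) auto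
    then have "\<forall>\<^sub>F n in sequentially. D * ((1/2) ^ n)\<^sup>2 < 1"
      by (rule order_tendstoD) simp
    then show ?thesis
    proof eventually_elim
      case (elim n)
      have "ennreal (2 * T) * d n \<le> energy r (\<lambda>x. u n x - w x) +
          ennreal D * (\<integral>\<^sup>+x. ennreal \<bar>u n x - w x\<bar> \<partial>lborel)\<^sup>2"
        unfolding T_def d_def D_def using r \<delta> by (intro energy_coercive) auto
      also have "\<dots> \<le> (2 * ennreal Q + 2 * ennreal Q) + ennreal D * (ennreal ((1/2) ^ n))\<^sup>2"
        by (intro add_mono order_trans[OF energy_diff_le] mult_left_mono power_mono w_L1 u_Q w_Q) auto
      also have "\<dots> = ennreal (4 * Q + D * ((1/2) ^ n)\<^sup>2)"
      proof -
        have "2 * ennreal Q + 2 * ennreal Q = ennreal (4 * Q)"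
          using \<open>Q \<ge> 0\<close> by (simp flip: ennreal_numeral ennreal_mult ennreal_plus)
        moreover have "ennreal D * (ennreal ((1/2) ^ n))\<^sup>2 = ennreal (D * ((1/2) ^ n)\<^sup>2)"
          using \<open>D \<ge> 0\<close> by (subst ennreal_power, simp, subst ennreal_mult', auto)
        ultimately show ?thesis using \<open>Q \<ge> 0\<close> \<open>D \<ge> 0\<close> by (subst ennreal_plus) auto
      qed
      also have "\<dots> \<le> ennreal (2 * T * \<eta>)" using T elim by (intro ennreal_leI) linarith
      also have "\<dots> = ennreal (2 * T) * ennreal \<eta>" using T by (subst ennreal_mult') auto
      finally show ?case using T by (subst (asm) ennreal_mult_le_mult_iff) auto
    qed
  qed
  define S where "S = (\<integral>\<^sup>+x. ennreal ((w x)\<^sup>2) \<partial>lborel)"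
  have S_fin: "S < \<infinity>"
  proof -
    obtain n where n: "d n \<le> ennreal 1"
      using eventually_happens'[OF _ d[of 1]] by auto
    have "S \<le> (\<integral>\<^sup>+x. 2 * ennreal ((u n x)\<^sup>2) + 2 * ennreal ((u n x - w x)\<^sup>2) \<partial>lborel)"
      unfolding S_def
    proof (rule nn_integral_mono)
      fix x
      have "(w x)\<^sup>2 \<le> 2 * (u n x)\<^sup>2 + 2 * (u n x - w x)\<^sup>2"
        using zero_le_power2[of "2 * u n x - w x"] by (simp add: power2_eq_square algebra_simps)
      from ennreal_leI[OF this] show "ennreal ((w x)\<^sup>2) \<le> 2 * ennreal ((u n x)\<^sup>2) + 2 * ennreal ((u n x - w x)\<^sup>2)"
        by (simp add: ennreal_mult' ennreal_plus)
    qed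
    also have "\<dots> = 2 * ennreal (g n) + 2 * d n"
      by (simp add: nn_integral_add nn_integral_cmult u_sq d_def)
    also have "\<dots> < \<infinity>" using n by (auto simp: ennreal_mult_less_top intro: le_less_trans)
    finally show ?thesis .
  qed
  \<comment> \<open>Each \<open>u n\<close> has integral 1, so a vanishing limit would be at L1
    distance 1. The index 1 is chosen because the rate there is 1/2; at index 0 it is 1 and gives no
    contradiction.\<close>
  have S_pos: "S \<noteq> 0"
  proof
    assume "S = 0"
    then have "AE x in lborel. w x = 0" by (simp add: S_def nn_integral_0_iff_AE)
    then have "(\<integral>\<^sup>+x. ennreal \<bar>u 1 x - w x\<bar> \<partial>lborel) = (\<integral>\<^sup>+x. ennreal (1 / A 1) * ennreal (v 1 x) \<partial>lborel)"
      using vD(2) A(2)[of 1] by (intro nn_integral_cong_AE) (auto simp: u_def ennreal_mult'[symmetric] elim!: eventually_mono)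
    also have "\<dots> = ennreal (1 / A 1) * ennreal (A 1)"
      using nonneg_sphere_integrable(2)[OF v \<Omega>] by (simp add: nn_integral_cmult A_def)
    also have "\<dots> = 1" using A(2)[of 1] by (simp flip: ennreal_mult)
    finally have "1 \<le> ennreal ((1/2) ^ 1)" using w_L1[of 1] by (simp only:)
    then show False unfolding ennreal_ge_1 by simp
  qed
  define S' where "S' = enn2real S"
  have S': "S = ennreal S'" "S' > 0"
    using S_fin S_pos by (auto simp: S'_def enn2real_positive_iff less_top zero_less_iff_neq_zero)
  define E' where "E' = enn2real (energy r w)"
  have E': "energy r w = ennreal E'" using w_Q le_less_trans[OF w_Q ennreal_less_top] by (simp add: E'_def)
  \<comment> \<open>Young's inequality bounds \<open>g n\<close> by \<open>1 + s\<close> times the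
    squared norm of \<open>w\<close> plus \<open>1 + 1 / s\<close> times \<open>d n\<close>. Once
    \<open>d n\<close> is below the square of \<open>s\<close>, the error is
    \<open>s\<^sup>2 + s\<close>, which vanishes as \<open>s\<close> tends to 0 and leaves the
    Rayleigh quotient of \<open>w\<close> at most \<open>m\<close>.\<close>
  have bound: "E' \<le> (m + s\<^sup>2) * ((1 + s) * S' + (s\<^sup>2 + s))" if "s > 0" for s
  proof -
    have gn: "ennreal (g n) \<le> ennreal ((1 + s) * S') + ennreal (1 + 1 / s) * d n" for n
    proof -
      have "ennreal (g n) \<le> (\<integral>\<^sup>+x. ennreal (1 + s) * ennreal ((w x)\<^sup>2) + ennreal (1 + 1 / s) * ennreal ((u n x - w x)\<^sup>2) \<partial>lborel)"
        unfolding u_sq[symmetric]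
      proof (rule nn_integral_mono)
        fix x
        have "0 \<le> s * (w x - (u n x - w x) / s)\<^sup>2" using that by simp
        also have "\<dots> = (1 + s) * (w x)\<^sup>2 + (1 + 1 / s) * (u n x - w x)\<^sup>2 - (u n x)\<^sup>2"
          using that by (simp add: power2_eq_square field_simps)
        finally have "(u n x)\<^sup>2 \<le> (1 + s) * (w x)\<^sup>2 + (1 + 1 / s) * (u n x - w x)\<^sup>2" by simp
        from ennreal_leI[OF this] show "ennreal ((u n x)\<^sup>2) \<le> ennreal (1 + s) * ennreal ((w x)\<^sup>2) + ennreal (1 + 1 / s) * ennreal ((u n x - w x)\<^sup>2)"
          using that by (subst (1 2) ennreal_mult[symmetric]) auto
      qed
      also have "\<dots> = ennreal (1 + s) * ennreal S' + ennreal (1 + 1 / s) * d n"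
        by (simp add: nn_integral_add nn_integral_cmult d_def flip: S_def S'(1))
      also have "ennreal (1 + s) * ennreal S' = ennreal ((1 + s) * S')"
        using that S'(2) by (intro ennreal_mult[symmetric]) auto
      finally show ?thesis .
    qed
    have "(\<lambda>n. 1 / (real n + 1)) \<longlonglongrightarrow> 0" by real_asymp
    then have "\<forall>\<^sub>F n in sequentially. 1 / (real n + 1) < s\<^sup>2"
      using that by (intro order_tendstoD) auto
    moreover have "\<forall>\<^sub>F n in sequentially. d n \<le> ennreal (s\<^sup>2)" using that by (intro d) simp
    ultimately have "\<forall>\<^sub>F n in sequentially. energy r (u n) \<le> ennreal ((m + s\<^sup>2) * ((1 + s) * S' + (s\<^sup>2 + s)))"
    proof eventually_elim
      case (elim n)
      have "ennreal (g n) \<le> ennreal ((1 + s) * S') + ennreal (1 + 1 / s) * ennreal (s\<^sup>2)"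
        using elim by (intro order_trans[OF gn] add_left_mono mult_left_mono) auto
      also have "\<dots> = ennreal ((1 + s) * S' + (1 + 1 / s) * s\<^sup>2)"
        using that S' by (subst ennreal_mult[symmetric]) auto
      also have "(1 + 1 / s) * s\<^sup>2 = s\<^sup>2 + s" using that by (simp add: field_simps power2_eq_square)
      finally have "g n \<le> (1 + s) * S' + (s\<^sup>2 + s)"
        using that S' by (subst (asm) ennreal_le_iff) auto
      then have "g n * (m + 1 / (real n + 1)) \<le> ((1 + s) * S' + (s\<^sup>2 + s)) * (m + s\<^sup>2)"
        using g(1) m0 elim that S' by (intro mult_mono) auto
      then show ?case by (intro order_trans[OF u_energy] ennreal_leI) (simp add: mult.commute)
    qed
    then have "ennreal E' \<le> ennreal ((m + s\<^sup>2) * ((1 + s) * S' + (s\<^sup>2 + s)))"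
      unfolding E'[symmetric] by (intro order_trans[OF Fatou] Liminf_le) auto
    then show ?thesis using that m0 S' by (subst (asm) ennreal_le_iff) auto
  qed
  have E_le: "E' \<le> m * S'"
  proof (rule tendsto_lowerbound)
    have "((\<lambda>s. (m + s\<^sup>2) * ((1 + s) * S' + (s\<^sup>2 + s))) \<longlongrightarrow> (m + 0\<^sup>2) * ((1 + 0) * S' + (0\<^sup>2 + 0))) (at_right 0)"
      by (intro tendsto_intros)
    then show "((\<lambda>s. (m + s\<^sup>2) * ((1 + s) * S' + (s\<^sup>2 + s))) \<longlongrightarrow> m * S') (at_right 0)" by simp
    show "\<forall>\<^sub>F s in at_right 0. E' \<le> (m + s\<^sup>2) * ((1 + s) * S' + (s\<^sup>2 + s))"
      by (rule eventually_mono[OF eventually_at_right_less bound])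
  qed simp
  define z where "z = (\<lambda>x. 1 / sqrt S' * w x)"
  have [measurable]: "z \<in> borel_measurable borel" unfolding z_def by measurable
  have "(\<integral>\<^sup>+x. ennreal ((z x)\<^sup>2) \<partial>lborel) = (\<integral>\<^sup>+x. ennreal (1 / S') * ennreal ((w x)\<^sup>2) \<partial>lborel)"
    using S'(2) by (intro nn_integral_cong) (simp add: z_def power_divide flip: ennreal_mult)
  also have "\<dots> = ennreal (1 / S') * ennreal S'"
    by (simp add: nn_integral_cmult flip: S_def S'(1))
  also have "\<dots> = 1" using S'(2) by (simp flip: ennreal_mult)
  finally have z1: "(\<integral>\<^sup>+x. ennreal ((z x)\<^sup>2) \<partial>lborel) = 1" .
  have "energy r z = ennreal (1 / S') * ennreal E'"
    unfolding z_def using S'(2) by (subst energy_scale) (auto simp: E' power_divide)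
  also have "\<dots> = ennreal (E' / S')" using S'(2) by (subst ennreal_mult'[symmetric]) auto
  also have "\<dots> \<le> ennreal m" using E_le S'(2) by (intro ennreal_leI) (simp add: pos_divide_le_eq)
  finally have "energy r z \<le> ennreal m" .
  then show ?thesis
    using z1 w_supp min by (intro bexI[of _ z]) (auto simp: z_def intro: order_trans)
qed

section \<open>The first eigenvalue\<close>

text \<open>A cone supported in a ball inside \<Omega> is 1-Lipschitz, so
  \<open>energy_upper\<close> applies, and it is then normalised. The same function serves all
  \<open>r\<close>, which is why \<open>K\<close> does not depend on \<open>r\<close>.\<close>

lemma nonneg_sphere_test_function:
  fixes \<Omega> :: "'a::euclidean_space set"
  assumes "open \<Omega>" "\<Omega> \<noteq> {}"
  shows "\<exists>K\<ge>0. \<forall>r. 0 < r \<and> r \<le> 1/2 \<longrightarrow>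
    (\<exists>v\<in>nonneg_sphere \<Omega>. energy r v \<le> ennreal (K + 2 * tail_mass TYPE('a) r 1))"
proof -
  obtain c \<rho> where \<rho>: "\<rho> > 0" "ball c \<rho> \<subseteq> \<Omega>"
    using assms by (meson all_not_in_conv open_contains_ball)
  define w where "w = (\<lambda>x::'a. max 0 (\<rho> - norm (x - c)))"
  have [measurable]: "w \<in> borel_measurable borel" unfolding w_def by measurable
  have w: "w x \<ge> 0" "w x \<le> \<rho>" "x \<notin> ball c \<rho> \<Longrightarrow> w x = 0" for x
    using \<rho>(1) by (auto simp: w_def dist_norm norm_minus_commute)
  have lip: "\<bar>w x - w y\<bar> \<le> norm (x - y)" for x y
    using norm_triangle_ineq2[of "x - c" "y - c"] norm_triangle_ineq2[of "y - c" "x - c"]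
    by (auto simp: w_def max_def norm_minus_commute abs_le_iff)
  define B where "B = enn2real (\<integral>\<^sup>+x. ennreal ((w x)\<^sup>2) \<partial>lborel)"
  have "(\<integral>\<^sup>+x. ennreal ((w x)\<^sup>2) \<partial>lborel) \<le> (\<integral>\<^sup>+x. ennreal (\<rho>\<^sup>2) * indicator (ball c \<rho>) x \<partial>lborel)"
    using w \<rho>(1) by (intro nn_integral_mono) (auto simp: indicator_def intro!: ennreal_leI power_mono)
  also have "\<dots> < \<infinity>"
    using emeasure_lborel_ball_finite[of c \<rho>] by (simp add: nn_integral_cmult_indicator ennreal_mult_less_top)
  finally have B: "(\<integral>\<^sup>+x. ennreal ((w x)\<^sup>2) \<partial>lborel) = ennreal B" by (simp add: B_def)
  have "ennreal ((\<rho>/2)\<^sup>2 * measure lborel (ball c (\<rho>/2))) =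
      (\<integral>\<^sup>+x. ennreal ((\<rho>/2)\<^sup>2) * indicator (ball c (\<rho>/2)) x \<partial>lborel)"
    using emeasure_lborel_ball_finite[of c "\<rho>/2"]
    by (simp add: nn_integral_cmult_indicator ennreal_mult emeasure_eq_ennreal_measure)
  also have "\<dots> \<le> ennreal B" unfolding B[symmetric]
  proof (rule nn_integral_mono)
    fix x :: 'a
    show "ennreal ((\<rho>/2)\<^sup>2) * indicator (ball c (\<rho>/2)) x \<le> ennreal ((w x)\<^sup>2)"
    proof (cases "x \<in> ball c (\<rho>/2)")
      case True
      then have "\<rho>/2 \<le> w x" by (simp add: w_def max_def dist_norm norm_minus_commute)
      then have "(\<rho>/2)\<^sup>2 \<le> (w x)\<^sup>2" using \<rho>(1) by (intro power_mono) auto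
      then show ?thesis using True by (simp add: ennreal_leI)
    qed simp
  qed
  finally have "(\<rho>/2)\<^sup>2 * measure lborel (ball c (\<rho>/2)) \<le> B"
    by (subst (asm) ennreal_le_iff) (auto simp: B_def)
  moreover have "0 < (\<rho>/2)\<^sup>2 * measure lborel (ball c (\<rho>/2))"
    using \<rho>(1) by (simp add: content_ball_pos)
  ultimately have B0: "B > 0" by linarith
  define v where "v = (\<lambda>x. 1 / sqrt B * w x)"
  have [measurable]: "v \<in> borel_measurable borel" unfolding v_def by measurable
  have "(\<integral>\<^sup>+x. ennreal ((v x)\<^sup>2) \<partial>lborel) = (\<integral>\<^sup>+x. ennreal (1 / B) * ennreal ((w x)\<^sup>2) \<partial>lborel)"
    using B0 by (intro nn_integral_cong) (simp add: v_def power_divide flip: ennreal_mult)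
  also have "\<dots> = ennreal (1 / B) * ennreal B" by (simp add: nn_integral_cmult flip: B)
  also have "\<dots> = 1" using B0 by (simp flip: ennreal_mult)
  finally have "(\<integral>\<^sup>+x. ennreal ((v x)\<^sup>2) \<partial>lborel) = 1" .
  moreover have "w x = 0" if "x \<notin> \<Omega>" for x using w(3) \<rho>(2) that by blast
  ultimately have v: "v \<in> nonneg_sphere \<Omega>"
    using w(1) B0 by (auto simp: nonneg_sphere_def v_def)
  define P where "P = near_mass TYPE('a) * measure lborel (cball c (\<rho> + 1))"
  have "P \<ge> 0" by (simp add: P_def near_mass_nonneg)
  have "energy r v \<le> ennreal (P / B + 2 * tail_mass TYPE('a) r 1)" if "0 < r" "r \<le> 1/2" for r
  proof -
    have "energy r v = ennreal (1 / B) * energy r w"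
      unfolding v_def using B0 by (subst energy_scale) (auto simp: power_divide)
    also have "\<dots> \<le> ennreal (1 / B) * (ennreal P + ennreal (2 * tail_mass TYPE('a) r 1) * ennreal B)"
      unfolding P_def B[symmetric] using that w lip by (intro mult_left_mono energy_upper) auto
    also have "\<dots> = ennreal (1 / B * (P + 2 * tail_mass TYPE('a) r 1 * B))"
      using B0 \<open>P \<ge> 0\<close> tail_mass_nonneg[of "TYPE('a)" r 1]
      by (subst ennreal_mult[symmetric], simp, simp, subst ennreal_plus[symmetric], simp, simp, subst ennreal_mult) auto
    also have "1 / B * (P + 2 * tail_mass TYPE('a) r 1 * B) = P / B + 2 * tail_mass TYPE('a) r 1"
      using B0 by (simp add: field_simps)
    finally show ?thesis .
  qed
  then show ?thesis using v B0 \<open>P \<ge> 0\<close> by (intro exI[of _ "P / B"]) auto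
qed

section \<open>Translation between the kernel formulation and the defined function spaces\<close>

lemma gagliardo_integrand_eq:
  "gagliardo_integrand r v (x, y) = (v x - v y)\<^sup>2 * frac_ker r (x - y)"
  unfolding gagliardo_integrand_def frac_ker_def powr_minus by (simp add: divide_inverse)

lemma C_const_eq:
  "C_const i r = inverse (\<integral>\<zeta>. (1 - cos (\<zeta> \<bullet> axis i 1)) * frac_ker r \<zeta> \<partial>(lborel :: (real^'n) measure))"
  unfolding C_const_def frac_ker_def powr_minus by (simp add: inner_axis divide_inverse)

text \<open>The formula for \<open>gagliardo_sq\<close> survives infinite energy: the Bochner
  integral of a non-integrable function and \<open>enn2real\<close> of infinity are both
  \<open>0\<close>.\<close>

lemma
  fixes v :: "real^'n \<Rightarrow> real"
  assumes [measurable]: "v \<in> borel_measurable borel"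
  shows H_space_iff_energy: "v \<in> H_space r \<longleftrightarrow> v \<in> L2 \<and> energy r v < \<infinity>"
    and gagliardo_sq_eq_energy: "gagliardo_sq r v = enn2real (energy r v)"
proof -
  have m: "gagliardo_integrand r v \<in> borel_measurable (lborel \<Otimes>\<^sub>M lborel)"
    unfolding gagliardo_integrand_def by measurable
  have nonneg: "0 \<le> gagliardo_integrand r v z" for z
    by (cases z) (simp add: gagliardo_integrand_eq)
  have "energy r v = (\<integral>\<^sup>+z. ennreal (gagliardo_integrand r v z) \<partial>(lborel \<Otimes>\<^sub>M lborel))"
    using m by (subst lborel.nn_integral_fst[symmetric]) (simp_all add: energy_def gagliardo_integrand_eq)
  then show "v \<in> H_space r \<longleftrightarrow> v \<in> L2 \<and> energy r v < \<infinity>" "gagliardo_sq r v = enn2real (energy r v)"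
    using m nonneg
    by (auto simp: H_space_def integrable_iff_bounded gagliardo_sq_def integral_eq_nn_integral)
qed

lemma L2_norm_eq_1_iff:
  fixes v :: "real^'n \<Rightarrow> real"
  assumes [measurable]: "v \<in> borel_measurable borel"
  shows "v \<in> L2 \<and> L2_norm v = 1 \<longleftrightarrow> (\<integral>\<^sup>+x. ennreal ((v x)\<^sup>2) \<partial>lborel) = 1"
proof -
  have "L2_norm v = 1 \<longleftrightarrow> enn2real (\<integral>\<^sup>+x. ennreal ((v x)\<^sup>2) \<partial>lborel) = 1"
    by (simp add: L2_norm_def integral_eq_nn_integral)
  moreover have "v \<in> L2 \<longleftrightarrow> (\<integral>\<^sup>+x. ennreal ((v x)\<^sup>2) \<partial>lborel) < \<infinity>"
    by (simp add: L2_def integrable_iff_bounded)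
  ultimately show ?thesis
    by (cases "\<integral>\<^sup>+x. ennreal ((v x)\<^sup>2) \<partial>lborel") auto
qed

text \<open>Passing to the absolute value contracts differences, and clearing the values outside
  \<Omega> changes the function only on a null set.\<close>

lemma X_space_to_nonneg_sphere:
  fixes v :: "real^'n \<Rightarrow> real"
  assumes v: "v \<in> X_space \<Omega> r" "L2_norm v = 1" and [measurable]: "\<Omega> \<in> sets borel"
  defines "w \<equiv> \<lambda>x. \<bar>v x\<bar> * indicator \<Omega> x"
  shows "w \<in> nonneg_sphere \<Omega>" "energy r w \<le> energy r v"
proof -
  have L2: "v \<in> L2" and supp: "AE x in lborel. x \<notin> \<Omega> \<longrightarrow> v x = 0"
    using v(1) by (auto simp: X_space_def H_space_def)
  then have [measurable]: "v \<in> borel_measurable borel" by (simp add: L2_def)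
  have ae: "AE x in lborel. w x = \<bar>v x\<bar>"
    using supp by eventually_elim (auto simp: w_def indicator_def)
  have "(\<integral>\<^sup>+x. ennreal ((w x)\<^sup>2) \<partial>lborel) = (\<integral>\<^sup>+x. ennreal ((v x)\<^sup>2) \<partial>lborel)"
    by (rule nn_integral_cong_AE, use ae in eventually_elim) simp
  also have "\<dots> = 1" using L2 v(2) L2_norm_eq_1_iff[of v] by simp
  finally show "w \<in> nonneg_sphere \<Omega>" by (simp add: nonneg_sphere_def w_def)
  have "energy r w = energy r (\<lambda>x. \<bar>v x\<bar>)" using ae by (rule energy_cong_AE)
  also have "\<dots> \<le> energy r v"
    using abs_triangle_ineq3 by (intro energy_mono) (simp add: abs_le_square_iff[symmetric])
  finally show "energy r w \<le> energy r v" .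
qed

text \<open>Both constants are independent of \<open>r\<close>, which is what the limit needs.
  Nonnegativity of \<open>C_const i r\<close> preserves the order when energies are multiplied by
  half of it; in the final limit it follows, for small \<open>r\<close>, from the
  asymptotics.\<close>

lemma first_eigenvalue_bounds:
  fixes \<Omega> :: "(real^'n) set" and i :: 'n
  assumes \<Omega>: "open \<Omega>" "\<Omega> \<noteq> {}" "bounded \<Omega>"
  shows "\<exists>K R. R > 0 \<and> (\<forall>r. 0 < r \<and> r \<le> 1/2 \<and> 0 \<le> C_const i r \<longrightarrow>
    R powr (- 2 * r) * (C_const i r * tail_mass TYPE(real^'n) r 1) \<le> first_eigenvalue i \<Omega> r \<and>
    first_eigenvalue i \<Omega> r \<le> C_const i r * K + C_const i r * tail_mass TYPE(real^'n) r 1)"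
proof -
  have [measurable]: "\<Omega> \<in> sets borel" using \<Omega>(1) by simp
  obtain a where a: "\<And>x. x \<in> \<Omega> \<Longrightarrow> norm x \<le> a" using \<Omega>(3) by (auto simp: bounded_iff)
  define R where "R = 2 * \<bar>a\<bar> + 1"
  have "R > 0" by (simp add: R_def add_nonneg_pos)
  have diam: "norm (x - y) < R" if "x \<in> \<Omega>" "y \<in> \<Omega>" for x y
    using norm_triangle_ineq4[of x y] a[OF that(1)] a[OF that(2)] by (simp add: R_def)
  have fin: "emeasure lborel \<Omega> < \<infinity>" by (rule emeasure_bounded_finite[OF \<Omega>(3)])
  obtain K where K: "K \<ge> 0" "\<And>r. 0 < r \<Longrightarrow> r \<le> 1/2 \<Longrightarrow>
      \<exists>v\<in>nonneg_sphere \<Omega>. energy r v \<le> ennreal (K + 2 * tail_mass TYPE(real^'n) r 1)"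
    using nonneg_sphere_test_function[OF \<Omega>(1,2)] by blast
  have "R powr (- 2 * r) * (C * tail_mass TYPE(real^'n) r 1) \<le> first_eigenvalue i \<Omega> r \<and>
    first_eigenvalue i \<Omega> r \<le> C * (K / 2) + C * tail_mass TYPE(real^'n) r 1"
    if r: "0 < r" "r \<le> 1/2" and C: "C_const i r = C" "0 \<le> C" for r C
  proof -
    define J where "J = tail_mass TYPE(real^'n) r 1"
    have "J \<ge> 0" by (simp add: J_def tail_mass_nonneg)
    obtain v where v: "v \<in> nonneg_sphere \<Omega>" "energy r v \<le> ennreal (K + 2 * J)"
      using K(2)[OF r] by (auto simp: J_def)
    have "\<exists>v\<in>nonneg_sphere \<Omega>. energy r v < \<infinity>"
      using v by (intro bexI[of _ v]) (auto intro: le_less_trans)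
    from energy_minimizer_exists[OF r(1) _ _ fin \<open>R > 0\<close> diam this] r
    obtain u where [measurable]: "u \<in> borel_measurable borel" and supp: "\<And>x. x \<notin> \<Omega> \<Longrightarrow> u x = 0"
      and u1: "(\<integral>\<^sup>+x. ennreal ((u x)\<^sup>2) \<partial>lborel) = 1"
      and min: "\<And>w. w \<in> nonneg_sphere \<Omega> \<Longrightarrow> energy r u \<le> energy r w"
      by auto
    have E_up: "energy r u \<le> ennreal (K + 2 * J)" using min[OF v(1)] v(2) by (rule order_trans)
    then have E_fin: "energy r u < \<infinity>" by (rule le_less_trans) simp
    define E where "E = enn2real (energy r u)"
    have E: "energy r u = ennreal E" "E \<ge> 0" using E_fin by (auto simp: E_def)
    have u: "u \<in> X_space \<Omega> r" "L2_norm u = 1"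
      using supp u1 E_fin L2_norm_eq_1_iff[of u] by (auto simp: X_space_def H_space_iff_energy)
    \<comment> \<open>Attainment by \<open>u\<close> is what gives \<open>LEAST\<close> its intended
      value. An arbitrary competitor is first replaced by a nonnegative one of no larger
      energy.\<close>
    have "first_eigenvalue i \<Omega> r = C / 2 * E"
      unfolding first_eigenvalue_def C
    proof (rule Least_equality)
      show "\<exists>v\<in>X_space \<Omega> r. L2_norm v = 1 \<and> C / 2 * E = C / 2 * gagliardo_sq r v"
        using u by (intro bexI[of _ u]) (auto simp: gagliardo_sq_eq_energy E_def)
      fix l assume "\<exists>v\<in>X_space \<Omega> r. L2_norm v = 1 \<and> l = C / 2 * gagliardo_sq r v"
      then obtain v where v: "v \<in> X_space \<Omega> r" "L2_norm v = 1" and l: "l = C / 2 * gagliardo_sq r v" by blast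
      then have [measurable]: "v \<in> borel_measurable borel" by (simp add: X_space_def H_space_def L2_def)
      have "energy r v < \<infinity>" using v(1) by (simp add: X_space_def H_space_iff_energy)
      moreover have "energy r u \<le> energy r v"
        using min X_space_to_nonneg_sphere[OF v] by (meson order_trans \<open>\<Omega> \<in> sets borel\<close>)
      ultimately have "E \<le> gagliardo_sq r v"
        by (simp add: gagliardo_sq_eq_energy E_def enn2real_mono)
      then show "C / 2 * E \<le> l" using C by (simp add: l mult_left_mono)
    qed
    moreover have "2 * (R powr (- 2 * r) * J) \<le> E"
      using energy_lower[of r R u \<Omega>] r \<open>R > 0\<close> supp diam E tail_mass_scale[of r R, where 'a = "real^'n"]
      by (simp add: u1 J_def)
    then have "C / 2 * (2 * (R powr (- 2 * r) * J)) \<le> C / 2 * E" using C by (intro mult_left_mono) auto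
    moreover have "E \<le> K + 2 * J"
      using E_up[unfolded E(1)] K(1) \<open>J \<ge> 0\<close> by (subst (asm) ennreal_le_iff) auto
    then have "C / 2 * E \<le> C / 2 * (K + 2 * J)" using C by (intro mult_left_mono) auto
    ultimately show ?thesis by (simp add: algebra_simps J_def)
  qed
  then show ?thesis using \<open>R > 0\<close> by blast
qed

theorem proposition2p2:
  fixes \<Omega> :: "(real^'n) set" and i :: 'n and r :: "nat \<Rightarrow> real"
  assumes "bounded_smooth_domain \<Omega>"
    and "\<And>k. 0 < r k \<and> r k < 1"
    and "decseq r"
    and "r \<longlonglongrightarrow> 0"
  shows "(\<lambda>k. first_eigenvalue i \<Omega> (r k)) \<longlonglongrightarrow> 1"
proof -
  have \<Omega>: "open \<Omega>" "\<Omega> \<noteq> {}" "bounded \<Omega>" using assms(1) by (auto simp: bounded_smooth_domain_def)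
  define C where "C = (C_const i :: real \<Rightarrow> real)"
  define J where "J = (\<lambda>s. tail_mass TYPE(real^'n) s 1)"
  obtain K R where "R > 0" and bounds: "\<And>s. 0 < s \<Longrightarrow> s \<le> 1/2 \<Longrightarrow> 0 \<le> C s \<Longrightarrow>
    R powr (- 2 * s) * (C s * J s) \<le> first_eigenvalue i \<Omega> s \<and>
    first_eigenvalue i \<Omega> s \<le> C s * K + C s * J s"
    using first_eigenvalue_bounds[OF \<Omega>, of i] unfolding C_def J_def by blast
  have J: "filterlim J at_top (at_right 0)" unfolding J_def by (rule tail_mass_at_top)
  then have J_pos: "\<forall>\<^sub>F s in at_right 0. J s > 0" by (simp add: filterlim_at_top_dense)
  have "((\<lambda>s. (\<integral>\<zeta>. (1 - cos (\<zeta> \<bullet> axis i 1)) * frac_ker s \<zeta> \<partial>(lborel :: (real^'n) measure)) / J s) \<longlongrightarrow> 1) (at_right 0)"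
    unfolding J_def by (rule integral_cos_frac_ker_asymptotic) simp
  from tendsto_inverse[OF this] have CJ: "((\<lambda>s. C s * J s) \<longlongrightarrow> 1) (at_right 0)"
    by (simp add: C_def C_const_eq divide_inverse inverse_mult_distrib)
  \<comment> \<open>Since \<open>C s * J s\<close> tends to 1 while \<open>J s\<close> tends to
    infinity, \<open>C s\<close> tends to 0; this removes the term \<open>C s * K\<close> from the
    upper bound.\<close>
  have "((\<lambda>s. C s * J s / J s) \<longlongrightarrow> 0) (at_right 0)"
    by (rule real_tendsto_divide_at_top[OF CJ J])
  then have C0: "(C \<longlongrightarrow> 0) (at_right 0)"
    by (rule Lim_transform_eventually) (use J_pos in \<open>auto elim: eventually_mono\<close>)
  have "\<forall>\<^sub>F s in at_right 0. C s * J s > 0" using CJ by (rule order_tendstoD) simp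
  moreover have "\<forall>\<^sub>F s in at_right 0. s \<in> {0<..<1/2::real}" by (rule eventually_at_right_real) simp
  ultimately have ev: "\<forall>\<^sub>F s in at_right 0. R powr (- 2 * s) * (C s * J s) \<le> first_eigenvalue i \<Omega> s \<and>
    first_eigenvalue i \<Omega> s \<le> C s * K + C s * J s"
    using J_pos by eventually_elim (intro bounds, auto simp: zero_less_mult_iff)
  have "((\<lambda>s. first_eigenvalue i \<Omega> s) \<longlongrightarrow> 1) (at_right 0)"
  proof (rule tendsto_sandwich)
    have "((\<lambda>s. R powr (- 2 * s)) \<longlongrightarrow> 1) (at_right 0)" using \<open>R > 0\<close> by real_asymp
    from tendsto_mult[OF this CJ]
    show "((\<lambda>s. R powr (- 2 * s) * (C s * J s)) \<longlongrightarrow> 1) (at_right 0)" by simp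
    from tendsto_add[OF tendsto_mult_right[OF C0, of K] CJ]
    show "((\<lambda>s. C s * K + C s * J s) \<longlongrightarrow> 1) (at_right 0)" by simp
  qed (use ev in \<open>auto elim: eventually_mono\<close>)
  \<comment> \<open>Positivity of every \<open>r k\<close> makes the convergence one-sided, so the
    limit along \<open>at_right 0\<close> transfers to the sequence.\<close>
  moreover have "filterlim r (at_right 0) sequentially"
    unfolding filterlim_at
  proof
    have "r k \<in> {0<..} \<and> r k \<noteq> 0" for k using assms(2)[of k] by auto
    then show "\<forall>\<^sub>F k in sequentially. r k \<in> {0<..} \<and> r k \<noteq> 0" by simp
  qed (rule assms(4))
  ultimately show ?thesis by (rule filterlim_compose)
qed

end
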